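(* Let $n\ge2$, and let $\Omega\subset\mathbb{R}^n\setminus\{0\}$ be a bounded open set with $\operatorname{dist}(\Omega,\{0\})>0$. Assume $$\frac1p\in\left(0,\frac1n\right)\cup\left(\frac1n,1\right],\qquad \frac1r\in\left(-\frac1n,1\right],\qquad a,c\in\mathbb{R}.$$ Let $\lambda,\theta\in[0,1]$ and define $q$ and $b$ by $$\frac1q=\theta\left(\frac1p-\frac\lambda n\right)+\frac{1-\theta}{r},\qquad b=\theta(1+a-\lambda)+(1-\theta)c .$$ Then there exists a constant $C=C(n,p,q,r,a,b,c,\lambda,\theta,\Omega)>0$ such that every $u\in C_c^\infty(\Omega)$ with $u\in X^{1,p,a}(\mathbb{R}^n)\cap X^{0,r,c}(\mathbb{R}^n)$ satisfies $u\in X^{0,q,b}(\mathbb{R}^n)$ and $$\big\||x|^{-b}u\big\|_{X^q(\mathbb{R}^n)}\le C\,\big\||x|^{-a}Du\big\|_{X^p(\mathbb{R}^n)}^{\theta}\,\big\||x|^{-c}u\big\|_{X^r(\mathbb{R}^n)}^{1-\theta}.$$ Moreover, the parameters satisfy the compatibility condition $$\frac1q-\frac bn=\theta\left(\frac1p-\frac{1+a}{n}\right)+(1-\theta)\left(\frac1r-\frac cn\right).$$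
   Context: Exponents are parametrized by their reciprocals: $1/p$ is a real number, $1/p=0$ means $p=\infty$, and $1/p<0$ means $p$ is a negative real number. Unified scale $X^p(\Omega)$ for an open set $\Omega\subset\mathbb{R}^n$ (including $\Omega=\mathbb{R}^n$): - if $0<p<\infty$, $X^p(\Omega)=L^p(\Omega)$ with $\|u\|_{X^p(\Omega)}=\left(\int_\Omega|u|^p\,dx\right)^{1/p}$; - if $p=\infty$, $X^\infty(\Omega)=L^\infty(\Omega)$ with the essential supremum norm; - if $-\infty<p<0$, put $(p)_1=-\left[\frac np+1\right]$ (with $[\cdot]$ the integer part, i.e. floor) and $(p)_2=-\frac np-(p)_1\in(0,1]$; then $X^p(\Omega)=C^{(p)_1,(p)_2}(\Omega)$ with $$\|u\|_{X^p(\Omega)}=\max_{|\alpha|\le (p)_1}\sup_{x\in\Omega}|D^\alpha u(x)|+\sum_{|\alpha|=(p)_1}\sup_{x,y\in\Omega,\ x\neq y}\frac{|D^\alpha u(x)-D^\alpha u(y)|}{|x-y|^{(p)_2}}.$$ (In particular, for $-\frac1n<\frac1p<0$ one has $(p)_1=0$ and $(p)_2=-\frac np\in(0,1)$.) Weighted spaces: for $k\in\mathbb{N}_0$ and $a\in\mathbb{R}$, $$X^{k,p,a}(\Omega)=\{u:\ |x|^{-a}D^\alpha u\in X^p(\Omega)\ \text{for all multi-indices } |\alpha|\le k\}$$ (derivatives in the weak sense). $Du=\nabla u$ is the gradient. Functions in $C_c^\infty(\Omega)$, and their products (and those of their derivatives) with powers of $|x|$, are extended by zero to $\mathbb{R}^n$.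 *)

theory Defs
  imports "HOL-Analysis.Analysis" "HOL-Probability.Essential_Supremum"
begin

section \<open>Partial derivatives and smooth functions\<close>

definition partial_deriv :: "'n \<Rightarrow> (real ^ 'n \<Rightarrow> 'b) \<Rightarrow> real ^ 'n \<Rightarrow> 'b::real_normed_vector" where
  "partial_deriv i u x = frechet_derivative u (at x) (axis i 1)"

definition grad :: "(real ^ 'n \<Rightarrow> real) \<Rightarrow> real ^ 'n \<Rightarrow> real ^ 'n" where
  "grad u x = (\<chi> i. partial_deriv i u x)"

type_synonym 'n multi_index = "'n \<Rightarrow> nat"

definition mi_order :: "('n::finite) multi_index \<Rightarrow> nat" where
  "mi_order \<alpha> = (\<Sum>i\<in>UNIV. \<alpha> i)"

text \<open>
  The index type carries no order, so the derivatives making up \<open>D\<^sup>\<alpha>\<close> are taken along an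
  arbitrary list in which each index \<open>i\<close> occurs \<open>\<alpha> i\<close> times. On functions of class \<open>C\<^sup>k\<close>,
  \<open>k \<ge> |\<alpha>|\<close>, the choice is immaterial by the symmetry of higher derivatives.
\<close>
definition mi_deriv ::
    "('n::finite) multi_index \<Rightarrow> (real ^ 'n \<Rightarrow> 'b) \<Rightarrow> real ^ 'n \<Rightarrow> 'b::real_normed_vector" where
  "mi_deriv \<alpha> u = foldr partial_deriv (SOME l. \<forall>i. count_list l i = \<alpha> i) u"

text \<open>\<open>C_k_on k u S\<close>: the function \<open>u\<close> is of class \<open>C\<^sup>k\<close> on the open set \<open>S\<close>.\<close>
primrec C_k_on :: "nat \<Rightarrow> (real ^ 'n \<Rightarrow> 'b::real_normed_vector) \<Rightarrow> (real ^ 'n) set \<Rightarrow> bool" where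
  "C_k_on 0 u S \<longleftrightarrow> continuous_on S u"
| "C_k_on (Suc k) u S \<longleftrightarrow>
     (\<forall>x\<in>S. u differentiable (at x)) \<and> (\<forall>i. C_k_on k (partial_deriv i u) S)"

text \<open>Elements of \<open>C\<^sub>c\<^sup>\<infinity>(\<Omega>)\<close> are total functions on the whole space, i.e. already extended by zero.\<close>
definition Cc_infty :: "(real ^ 'n) set \<Rightarrow> (real ^ 'n \<Rightarrow> real) set" where
  "Cc_infty \<Omega> = {u. (\<forall>k. C_k_on k u UNIV) \<and> compact (closure {x. u x \<noteq> 0}) \<and>
                    closure {x. u x \<noteq> 0} \<subseteq> \<Omega>}"


section \<open>The unified scale\<close>

text \<open>
  Throughout, the parameter \<open>s\<close> is the reciprocal \<open>1/p\<close>, with \<open>s = 0\<close> for \<open>p = \<infinity>\<close>.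
  For \<open>s < 0\<close>, \<open>hoelder_order\<close> and \<open>hoelder_exp\<close> are \<open>(p)\<^sub>1\<close> and \<open>(p)\<^sub>2\<close> in dimension \<open>n\<close>;
  there \<open>\<lfloor>n s + 1\<rfloor> \<le> 0\<close>, so the conversion to \<open>nat\<close> does not truncate.
\<close>
definition hoelder_order :: "nat \<Rightarrow> real \<Rightarrow> nat" where
  "hoelder_order n s = nat (- \<lfloor>real n * s + 1\<rfloor>)"

definition hoelder_exp :: "nat \<Rightarrow> real \<Rightarrow> real" where
  "hoelder_exp n s = - real n * s - real (hoelder_order n s)"

definition Lp_enorm :: "real \<Rightarrow> (real ^ 'n) set \<Rightarrow> (real ^ 'n \<Rightarrow> 'b::real_normed_vector) \<Rightarrow> ennreal" where
  "Lp_enorm s \<Omega> u =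
     (let I = (\<integral>\<^sup>+ x. ennreal (norm (u x) powr (1 / s)) \<partial>lebesgue_on \<Omega>)
      in if I = \<infinity> then \<infinity> else ennreal (enn2real I powr s))"

definition hoelder_enorm ::
    "nat \<Rightarrow> real \<Rightarrow> (real ^ 'n) set \<Rightarrow> (real ^ 'n \<Rightarrow> 'b::real_normed_vector) \<Rightarrow> ennreal" where
  "hoelder_enorm k h \<Omega> u =
     (MAX \<alpha> \<in> {\<alpha>. mi_order \<alpha> \<le> k}. SUP x\<in>\<Omega>. ennreal (norm (mi_deriv \<alpha> u x))) +
     (\<Sum>\<alpha> | mi_order \<alpha> = k. SUP (x, y) \<in> {(x, y). x \<in> \<Omega> \<and> y \<in> \<Omega> \<and> x \<noteq> y}.
        ennreal (norm (mi_deriv \<alpha> u x - mi_deriv \<alpha> u y) / norm (x - y) powr h))"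

definition X_enorm :: "real \<Rightarrow> (real ^ 'n) set \<Rightarrow> (real ^ 'n \<Rightarrow> 'b::real_normed_vector) \<Rightarrow> ennreal" where
  "X_enorm s \<Omega> u =
     (if s > 0 then Lp_enorm s \<Omega> u
      else if s = 0 then esssup (lebesgue_on \<Omega>) (\<lambda>x. ennreal (norm (u x)))
      else hoelder_enorm (hoelder_order CARD('n) s) (hoelder_exp CARD('n) s) \<Omega> u)"

definition X_space :: "real \<Rightarrow> (real ^ 'n) set \<Rightarrow> (real ^ 'n \<Rightarrow> 'b::real_normed_vector) set" where
  "X_space s \<Omega> =
     {u. (if s \<ge> 0 then u \<in> borel_measurable (lebesgue_on \<Omega>)
          else C_k_on (hoelder_order CARD('n) s) u \<Omega>) \<and> X_enorm s \<Omega> u < \<infinity>}"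

definition X_norm :: "real \<Rightarrow> (real ^ 'n) set \<Rightarrow> (real ^ 'n \<Rightarrow> 'b::real_normed_vector) \<Rightarrow> real" where
  "X_norm s \<Omega> u = enn2real (X_enorm s \<Omega> u)"


section \<open>Weighted spaces\<close>

text \<open>
  The value at the origin is always \<open>0\<close> (in Isabelle even \<open>0 powr 0 = 0\<close>). This is harmless
  for functions vanishing near the origin; see also \<open>X_weighted\<close>.
\<close>
definition weighted :: "real \<Rightarrow> (real ^ 'n \<Rightarrow> 'b::real_normed_vector) \<Rightarrow> real ^ 'n \<Rightarrow> 'b" where
  "weighted a u x = (norm x powr a) *\<^sub>R u x"

definition locally_integrable :: "(real ^ 'n) set \<Rightarrow> (real ^ 'n \<Rightarrow> real) \<Rightarrow> bool" where
  "locally_integrable \<Omega> u \<longleftrightarrow> (\<forall>K. compact K \<and> K \<subseteq> \<Omega> \<longrightarrow> set_integrable lebesgue K u)"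

definition weak_deriv ::
    "(real ^ 'n) set \<Rightarrow> 'n multi_index \<Rightarrow> (real ^ 'n \<Rightarrow> real) \<Rightarrow> (real ^ 'n \<Rightarrow> real) \<Rightarrow> bool" where
  "weak_deriv \<Omega> \<alpha> u v \<longleftrightarrow> locally_integrable \<Omega> u \<and> locally_integrable \<Omega> v \<and>
     (\<forall>\<phi>\<in>Cc_infty \<Omega>. (LINT x:\<Omega>|lebesgue. u x * mi_deriv \<alpha> \<phi> x) =
                      (-1) ^ mi_order \<alpha> * (LINT x:\<Omega>|lebesgue. v x * \<phi> x))"

text \<open>
  A weak derivative \<open>v\<close> is determined only almost everywhere, so \<open>|x|\<^sup>-\<^sup>a v \<in> X\<^sup>p(\<Omega>)\<close> is read as:
  \<open>|x|\<^sup>-\<^sup>a v\<close> has a representative \<open>w\<close> in \<open>X\<^sup>p(\<Omega>)\<close> (this matters when \<open>p < 0\<close>). For \<open>\<alpha> = 0\<close> the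
  derivative is \<open>u\<close> itself, and no local integrability is asked for.
\<close>
definition X_weighted :: "nat \<Rightarrow> real \<Rightarrow> real \<Rightarrow> (real ^ 'n) set \<Rightarrow> (real ^ 'n \<Rightarrow> real) set" where
  "X_weighted k s a \<Omega> =
     {u. \<forall>\<alpha>. mi_order \<alpha> \<le> k \<longrightarrow>
        (\<exists>v w. (if mi_order \<alpha> = 0 then v = u else weak_deriv \<Omega> \<alpha> u v) \<and>
               w \<in> X_space s \<Omega> \<and> (AE x in lebesgue_on \<Omega>. w x = weighted (- a) v x))}"

end

theory Submission
  imports Defs
begin

text \<open>
Since \<open>\<Omega>\<close> is bounded and keeps a positive distance from the origin, functions supported in \<open>\<Omega>\<close>
live on an annulus, where multiplication by a power of \<open>norm x\<close> changes the norms by at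
most a constant factor (\<open>scale_le_weighted\<close>). It therefore suffices to prove the inequality without
weights, and the compatibility condition is plain arithmetic.

The unweighted inequality is the composition of two facts. With \<open>t = 1 / p - \<lambda> / n\<close>, the first one
bounds \<open>u\<close> at the reciprocal exponent \<open>t\<close> by the \<open>L\<^sup>p\<close> norm of its gradient (\<open>gradient_embedding\<close>). For \<open>\<lambda> = 1\<close>
this is the Sobolev inequality when \<open>p < n\<close> and the Morrey inequality when \<open>p > n\<close>; for smaller
\<open>\<lambda>\<close> it follows because the scale is nested on functions with support in a fixed ball. The second
one interpolates between the reciprocal exponents \<open>t\<close> and \<open>1 / r\<close> (\<open>scale_le_interpolate\<close>). Between two
Lebesgue spaces this is Hoelder's inequality, between two Hoelder spaces it is a pointwise geometric
mean, and between a Hoelder and a Lebesgue space it passes through \<open>L\<^sup>\<infinity>\<close>: a function with a Hoelder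
bound that is large at a point is large on a whole ball, which its Lebesgue norm limits
(\<open>sup_le_hoelder_Lp\<close>). All reciprocal exponents that occur exceed \<open>- 1 / n\<close>, so that the Hoelder spaces involve
no derivatives.

The Sobolev inequality with the sharp exponent, \<open>p = 1\<close> included, comes from Gagliardo's argument:
\<open>u\<close> is bounded by the integral of its gradient along every coordinate line, and a product of \<open>n\<close>
functions each omitting one coordinate is controlled by Finner's inequality (\<open>finner_inequality\<close>).
Morrey's inequality compares point values with the mean over a ball (\<open>morrey_mean_oscillation\<close>).
\<close>

section \<open>Powers of extended nonnegative reals and the Hoelder inequality\<close>

text \<open>
Real powers on \<open>[0, \<infinity>]\<close>, with \<open>\<infinity>\<close> fixed by every exponent. This is the convention built into
\<open>Lp_enorm\<close>; it makes \<open>x \<mapsto> epow x \<alpha>\<close> multiplicative without side conditions, so that the product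
inequalities below can be proved before any integral is known to be finite.
\<close>
definition epow :: "ennreal \<Rightarrow> real \<Rightarrow> ennreal" where
  "epow x \<alpha> = (if x = \<infinity> then \<infinity> else ennreal (enn2real x powr \<alpha>))"

lemma epow_ennreal: "r \<ge> 0 \<Longrightarrow> epow (ennreal r) \<alpha> = ennreal (r powr \<alpha>)"
  by (simp add: epow_def)

lemma epow_top [simp]: "epow top \<alpha> = top"
  by (simp add: epow_def)

lemma epow_0 [simp]: "epow 0 \<alpha> = 0"
  by (simp add: epow_def)

lemma epow_eq_0_iff: "epow x \<alpha> = 0 \<longleftrightarrow> x = 0"
  by (cases x) (auto simp: epow_def)

lemma borel_measurable_epow [measurable (raw)]:
  assumes [measurable]: "f \<in> borel_measurable M"
  shows "(\<lambda>x. epow (f x) \<alpha>) \<in> borel_measurable M"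
  unfolding epow_def by measurable

lemma epow_mult: "epow (x * y) \<alpha> = epow x \<alpha> * epow y \<alpha>"
proof (cases x; cases y)
  fix r s assume "0 \<le> r" "x = ennreal r" "0 \<le> s" "y = ennreal s"
  then show ?thesis
    by (simp add: ennreal_mult[symmetric] epow_ennreal powr_mult)
next
  fix r assume *: "0 \<le> r" "x = ennreal r" "y = top"
  show ?thesis
  proof (cases "r = 0")
    case False
    with * have "x * y = \<infinity>" "epow x \<alpha> * epow y \<alpha> = \<infinity>"
      by (auto simp: ennreal_mult_top epow_ennreal epow_def)
    then show ?thesis by simp
  qed (use * in simp)
next
  fix s assume *: "0 \<le> s" "y = ennreal s" "x = top"
  show ?thesis
  proof (cases "s = 0")
    case False
    with * have "x * y = \<infinity>" "epow x \<alpha> * epow y \<alpha> = \<infinity>"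
      by (auto simp: ennreal_top_mult epow_ennreal epow_def)
    then show ?thesis by simp
  qed (use * in simp)
next
  assume "x = top" "y = top"
  then show ?thesis by (simp add: epow_def)
qed

lemma epow_mono:
  assumes "x \<le> y" "0 \<le> \<alpha>"
  shows "epow x \<alpha> \<le> epow y \<alpha>"
proof (cases "y = \<infinity>")
  case False
  then have "x < \<infinity>" "y < \<infinity>" using assms by (auto simp: less_top order_le_less_trans)
  then have "enn2real x \<le> enn2real y" using assms by (simp add: enn2real_mono)
  with \<open>x < \<infinity>\<close> \<open>y < \<infinity>\<close> assms show ?thesis
    by (auto simp: epow_def intro!: ennreal_leI powr_mono2)
qed simp

lemma epow_add: "epow x (\<alpha> + \<beta>) = epow x \<alpha> * epow x \<beta>"
  by (cases x) (auto simp: epow_def powr_add ennreal_mult ennreal_top_mult)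

lemma prod_epow_same:
  assumes "finite K" "K \<noteq> {}"
  shows "(\<Prod>k\<in>K. epow x (\<alpha> k)) = epow x (\<Sum>k\<in>K. \<alpha> k)"
  using assms by (induction K rule: finite_ne_induct) (auto simp: epow_add)

text \<open>
Weighted arithmetic-geometric mean inequality: for positive finite factors it is the convexity of
\<open>exp\<close> evaluated at the logarithms. A vanishing factor kills the left side, and an infinite one makes
the right side infinite because its weight is positive.
\<close>
lemma prod_epow_le_sum:
  fixes f :: "'k \<Rightarrow> ennreal"
  assumes K: "finite K" and \<alpha>: "\<And>k. k \<in> K \<Longrightarrow> \<alpha> k > 0" "(\<Sum>k\<in>K. \<alpha> k) = 1"
  shows "(\<Prod>k\<in>K. epow (f k) (\<alpha> k)) \<le> (\<Sum>k\<in>K. ennreal (\<alpha> k) * f k)"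
proof -
  have ne: "K \<noteq> {}" using \<alpha>(2) by auto
  consider "\<exists>k\<in>K. f k = 0" | "\<exists>k\<in>K. f k = \<infinity>" | "\<And>k. k \<in> K \<Longrightarrow> f k \<noteq> 0 \<and> f k \<noteq> \<infinity>"
    by blast
  then show ?thesis
  proof cases
    case 1
    then have "(\<Prod>k\<in>K. epow (f k) (\<alpha> k)) = 0" using K by (intro prod_zero) (auto simp: epow_eq_0_iff)
    then show ?thesis by (metis zero_le)
  next
    case 2
    then obtain k where k: "k \<in> K" "f k = \<infinity>" by blast
    have "\<infinity> = ennreal (\<alpha> k) * f k" using k \<alpha>(1)[of k] by (simp add: ennreal_mult_top)
    also have "\<dots> \<le> (\<Sum>k\<in>K. ennreal (\<alpha> k) * f k)" using k K by (intro member_le_sum) auto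
    finally show ?thesis by (metis infinity_ennreal_def top_greatest order_trans)
  next
    case 3
    define g where "g k = enn2real (f k)" for k
    have g: "f k = ennreal (g k)" "g k > 0" if "k \<in> K" for k
      using 3[OF that] by (auto simp: g_def enn2real_positive_iff less_top zero_less_iff_neq_zero)
    have "(\<Prod>k\<in>K. epow (f k) (\<alpha> k)) = (\<Prod>k\<in>K. ennreal (g k powr \<alpha> k))"
      using g by (intro prod.cong) (auto simp: epow_ennreal less_imp_le)
    also have "\<dots> = ennreal (\<Prod>k\<in>K. g k powr \<alpha> k)" by (intro prod_ennreal) auto
    also have "(\<Prod>k\<in>K. g k powr \<alpha> k) = exp (\<Sum>k\<in>K. \<alpha> k *\<^sub>R ln (g k))"
      unfolding exp_sum[OF K] using g(2) by (intro prod.cong) (force simp: powr_def)+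
    also have "\<dots> \<le> (\<Sum>k\<in>K. \<alpha> k * exp (ln (g k)))"
      using convex_on_sum[OF K ne exp_convex \<alpha>(2), of "\<lambda>k. ln (g k)"] \<alpha>(1)
      by (auto simp: less_imp_le)
    also have "\<dots> = (\<Sum>k\<in>K. \<alpha> k * g k)" using g by (intro sum.cong) auto
    finally have "(\<Prod>k\<in>K. epow (f k) (\<alpha> k)) \<le> ennreal (\<Sum>k\<in>K. \<alpha> k * g k)" by (simp add: ennreal_leI)
    also have "\<dots> = (\<Sum>k\<in>K. ennreal (\<alpha> k * g k))"
      using g \<alpha> by (intro sum_ennreal[symmetric]) (auto simp: less_imp_le)
    also have "\<dots> = (\<Sum>k\<in>K. ennreal (\<alpha> k) * f k)"
      using g \<alpha> by (intro sum.cong) (auto simp: ennreal_mult less_imp_le)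
    finally show ?thesis .
  qed
qed

text \<open>
Hoelder's inequality for finitely many functions. After dividing each factor by its integral the
arithmetic-geometric mean inequality can be integrated termwise, and the weights add up to \<open>1\<close>.
\<close>
lemma nn_integral_prod_epow_le:
  fixes f :: "'k \<Rightarrow> 'a \<Rightarrow> ennreal"
  assumes K: "finite K" and \<alpha>: "\<And>k. k \<in> K \<Longrightarrow> \<alpha> k > 0" "(\<Sum>k\<in>K. \<alpha> k) = 1"
    and f [measurable]: "\<And>k. k \<in> K \<Longrightarrow> f k \<in> borel_measurable M"
  shows "(\<integral>\<^sup>+x. (\<Prod>k\<in>K. epow (f k x) (\<alpha> k)) \<partial>M) \<le> (\<Prod>k\<in>K. epow (\<integral>\<^sup>+x. f k x \<partial>M) (\<alpha> k))"
proof -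
  define A where "A k = (\<integral>\<^sup>+x. f k x \<partial>M)" for k
  consider (zero) "\<exists>k\<in>K. A k = 0"
    | (top) "\<And>k. k \<in> K \<Longrightarrow> A k \<noteq> 0" "\<exists>k\<in>K. A k = \<infinity>"
    | (reg) "\<And>k. k \<in> K \<Longrightarrow> A k \<noteq> 0 \<and> A k \<noteq> \<infinity>"
    by blast
  then show ?thesis
  proof cases
    case zero
    then obtain k where k: "k \<in> K" "A k = 0" by blast
    then have "AE x in M. f k x = 0" by (simp add: A_def nn_integral_0_iff_AE)
    then have "AE x in M. (\<Prod>k\<in>K. epow (f k x) (\<alpha> k)) = 0"
      by eventually_elim (use k K in \<open>auto simp: prod_zero_iff epow_eq_0_iff\<close>)
    then have "(\<integral>\<^sup>+x. (\<Prod>k\<in>K. epow (f k x) (\<alpha> k)) \<partial>M) = 0"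
      by (subst nn_integral_0_iff_AE) auto
    then show ?thesis by simp
  next
    case top
    then have "(\<Prod>k\<in>K. epow (A k) (\<alpha> k)) = \<infinity>"
      using K by (auto simp: ennreal_prod_eq_top epow_eq_0_iff intro!: bexI)
    then show ?thesis by (simp add: A_def)
  next
    case reg
    have split: "f k x = A k * (f k x / A k)" if "k \<in> K" for k x
      using reg[OF that] by (simp add: ennreal_times_divide ennreal_mult_divide_eq mult.commute[of "A k"])
    have "(\<integral>\<^sup>+x. (\<Prod>k\<in>K. epow (f k x) (\<alpha> k)) \<partial>M)
        = (\<integral>\<^sup>+x. (\<Prod>k\<in>K. epow (A k) (\<alpha> k)) * (\<Prod>k\<in>K. epow (f k x / A k) (\<alpha> k)) \<partial>M)"
      unfolding prod.distrib[symmetric] epow_mult[symmetric]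
      using split by (intro nn_integral_cong prod.cong refl) metis
    also have "\<dots> = (\<Prod>k\<in>K. epow (A k) (\<alpha> k)) * (\<integral>\<^sup>+x. (\<Prod>k\<in>K. epow (f k x / A k) (\<alpha> k)) \<partial>M)"
      by (intro nn_integral_cmult) auto
    also have "(\<integral>\<^sup>+x. (\<Prod>k\<in>K. epow (f k x / A k) (\<alpha> k)) \<partial>M)
        \<le> (\<integral>\<^sup>+x. (\<Sum>k\<in>K. ennreal (\<alpha> k) * (f k x / A k)) \<partial>M)"
      by (intro nn_integral_mono prod_epow_le_sum K \<alpha>)
    also have "\<dots> = (\<Sum>k\<in>K. ennreal (\<alpha> k) * (\<integral>\<^sup>+x. f k x / A k \<partial>M))"
      by (subst nn_integral_sum) (auto intro!: sum.cong nn_integral_cmult)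
    also have "\<dots> = (\<Sum>k\<in>K. ennreal (\<alpha> k))"
    proof (intro sum.cong refl)
      fix k assume k: "k \<in> K"
      have "(\<integral>\<^sup>+x. f k x / A k \<partial>M) = A k / A k"
        using k by (simp add: A_def nn_integral_divide)
      then show "ennreal (\<alpha> k) * (\<integral>\<^sup>+x. f k x / A k \<partial>M) = ennreal (\<alpha> k)"
        using reg[OF k] by (simp add: ennreal_divide_self less_top zero_less_iff_neq_zero)
    qed
    also have "\<dots> = 1" using \<alpha> by (subst sum_ennreal) (auto simp: less_imp_le)
    finally show ?thesis by (simp add: A_def mult_left_mono)
  qed
qed

section \<open>Finner's and Gagliardo's inequalities\<close>

text \<open>
The functions \<open>f k\<close> depend only on the coordinates in \<open>S k\<close>, and the weights of the functions
that see a given coordinate add up to \<open>1\<close>. Coordinates can therefore be integrated out one at a time: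
Hoelder's inequality applies to exactly those factors that depend on the current coordinate, the
others are constants, and the factors that remain satisfy the same hypothesis on fewer coordinates.
The Loomis-Whitney and Gagliardo inequalities are the case in which \<open>S k\<close> omits one coordinate.
\<close>
lemma (in product_sigma_finite) finner_inequality:
  fixes f :: "'k \<Rightarrow> ('i \<Rightarrow> 'a) \<Rightarrow> ennreal"
  assumes "finite I" "finite K"
    and "\<And>k. k \<in> K \<Longrightarrow> S k \<subseteq> I"
    and "\<And>k. k \<in> K \<Longrightarrow> \<alpha> k > 0"
    and "\<And>i. i \<in> I \<Longrightarrow> (\<Sum>k | k \<in> K \<and> i \<in> S k. \<alpha> k) = 1"
    and "\<And>k. k \<in> K \<Longrightarrow> f k \<in> borel_measurable (Pi\<^sub>M (S k) M)"
  shows "(\<integral>\<^sup>+x. (\<Prod>k\<in>K. epow (f k (restrict x (S k))) (\<alpha> k)) \<partial>Pi\<^sub>M I M)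
          \<le> (\<Prod>k\<in>K. epow (\<integral>\<^sup>+x. f k x \<partial>Pi\<^sub>M (S k) M) (\<alpha> k))"
  using assms
proof (induction I arbitrary: S f rule: finite_induct)
  case empty
  then have S: "S k = {}" if "k \<in> K" for k using that by auto
  have "(\<integral>\<^sup>+x. (\<Prod>k\<in>K. epow (f k (restrict x (S k))) (\<alpha> k)) \<partial>Pi\<^sub>M {} M)
      = (\<Prod>k\<in>K. epow (f k (restrict (\<lambda>_. undefined) (S k))) (\<alpha> k))"
    by (rule nn_integral_empty) simp
  also have "\<dots> = (\<Prod>k\<in>K. epow (\<integral>\<^sup>+x. f k x \<partial>Pi\<^sub>M (S k) M) (\<alpha> k))"
    by (intro prod.cong refl) (auto simp: S nn_integral_empty restrict_def)
  finally show ?case by (rule eq_refl)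
next
  case (insert j I)
  note K = \<open>finite K\<close> and \<alpha> = insert.prems(3,4)
  \<comment> \<open>Integrating out coordinate \<open>j\<close> removes it from every \<open>S k\<close> and integrates the functions that see it.\<close>
  define S' where "S' k = S k - {j}" for k
  define f' where "f' k = (if j \<in> S k then (\<lambda>z. \<integral>\<^sup>+y. f k (z(j := y)) \<partial>M j) else f k)" for k
  have fm: "f k \<in> borel_measurable (Pi\<^sub>M (S k) M)" if "k \<in> K" for k using insert.prems that by blast
  have Sins: "S k = insert j (S' k)" if "j \<in> S k" for k using that by (auto simp: S'_def)
  have Sno: "S' k = S k" if "j \<notin> S k" for k using that by (auto simp: S'_def)
  have f'm: "f' k \<in> borel_measurable (Pi\<^sub>M (S' k) M)" if k: "k \<in> K" for k
  proof (cases "j \<in> S k")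
    case True
    have [measurable]: "f k \<in> borel_measurable (Pi\<^sub>M (insert j (S' k)) M)"
      using fm[OF k] Sins[OF True] by simp
    show ?thesis using True unfolding f'_def by simp
  next
    case False then show ?thesis using fm[OF k] by (simp add: f'_def Sno)
  qed
  have intf': "(\<integral>\<^sup>+x. f' k x \<partial>Pi\<^sub>M (S' k) M) = (\<integral>\<^sup>+x. f k x \<partial>Pi\<^sub>M (S k) M)" if k: "k \<in> K" for k
  proof (cases "j \<in> S k")
    case True
    have "finite (S' k)" using k insert.prems(2)[OF k] insert.hyps(1) finite_subset[of "S k"]
      by (auto simp: S'_def)
    then have "(\<integral>\<^sup>+x. f k x \<partial>Pi\<^sub>M (insert j (S' k)) M) = (\<integral>\<^sup>+x. \<integral>\<^sup>+y. f k (x(j := y)) \<partial>M j \<partial>Pi\<^sub>M (S' k) M)"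
      using fm[OF k, unfolded Sins[OF True]] by (intro product_nn_integral_insert) (auto simp: S'_def)
    then show ?thesis using True Sins[OF True] by (simp add: f'_def)
  next
    case False then show ?thesis by (simp add: f'_def Sno)
  qed
  have restr: "restrict (x(j := y)) (S k)
      = (if j \<in> S k then (restrict x (S' k))(j := y) else restrict x (S' k))" for x y k
    by (auto simp: S'_def fun_eq_iff)
  have inner: "(\<integral>\<^sup>+y. (\<Prod>k\<in>K. epow (f k (restrict (x(j := y)) (S k))) (\<alpha> k)) \<partial>M j)
      \<le> (\<Prod>k\<in>K. epow (f' k (restrict x (S' k))) (\<alpha> k))" if x: "x \<in> space (Pi\<^sub>M I M)" for x
  proof -
    define K1 where "K1 = {k\<in>K. j \<in> S k}"
    define K2 where "K2 = {k\<in>K. j \<notin> S k}"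
    have KK: "K = K1 \<union> K2" "K1 \<inter> K2 = {}" "finite K1" "finite K2" using K by (auto simp: K1_def K2_def)
    have xr: "restrict x (S' k) \<in> space (Pi\<^sub>M (S' k) M)" if "k \<in> K" for k
    proof -
      have "S' k \<subseteq> I" using insert.prems(2)[OF that] by (auto simp: S'_def)
      then show ?thesis using x by (auto simp: space_PiM PiE_def)
    qed
    have m: "(\<lambda>y. f k ((restrict x (S' k))(j := y))) \<in> borel_measurable (M j)" if "k \<in> K1" for k
    proof -
      have k: "k \<in> K" "j \<in> S k" using that by (auto simp: K1_def)
      have "(\<lambda>y. (restrict x (S' k))(j := y)) \<in> measurable (M j) (Pi\<^sub>M (insert j (S' k)) M)"
        by (rule measurable_component_update[OF xr[OF k(1)]]) (simp add: S'_def)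
      then show ?thesis using fm[OF k(1)] Sins[OF k(2)] by (simp add: measurable_compose)
    qed
    have "(\<integral>\<^sup>+y. (\<Prod>k\<in>K. epow (f k (restrict (x(j := y)) (S k))) (\<alpha> k)) \<partial>M j)
       = (\<integral>\<^sup>+y. (\<Prod>k\<in>K2. epow (f' k (restrict x (S' k))) (\<alpha> k)) *
                (\<Prod>k\<in>K1. epow (f k ((restrict x (S' k))(j := y))) (\<alpha> k)) \<partial>M j)"
    proof (intro nn_integral_cong)
      fix y
      have "(\<Prod>k\<in>K. epow (f k (restrict (x(j := y)) (S k))) (\<alpha> k))
        = (\<Prod>k\<in>K2. epow (f k (restrict (x(j := y)) (S k))) (\<alpha> k)) *
          (\<Prod>k\<in>K1. epow (f k (restrict (x(j := y)) (S k))) (\<alpha> k))"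
        by (subst KK(1), subst prod.union_disjoint[OF KK(3,4,2)]) (rule mult.commute)
      also have "(\<Prod>k\<in>K2. epow (f k (restrict (x(j := y)) (S k))) (\<alpha> k))
          = (\<Prod>k\<in>K2. epow (f' k (restrict x (S' k))) (\<alpha> k))"
        by (intro prod.cong refl) (simp add: K2_def restr f'_def)
      also have "(\<Prod>k\<in>K1. epow (f k (restrict (x(j := y)) (S k))) (\<alpha> k))
          = (\<Prod>k\<in>K1. epow (f k ((restrict x (S' k))(j := y))) (\<alpha> k))"
        by (intro prod.cong refl) (simp add: K1_def restr)
      finally show "(\<Prod>k\<in>K. epow (f k (restrict (x(j := y)) (S k))) (\<alpha> k))
        = (\<Prod>k\<in>K2. epow (f' k (restrict x (S' k))) (\<alpha> k)) *
          (\<Prod>k\<in>K1. epow (f k ((restrict x (S' k))(j := y))) (\<alpha> k))" .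
    qed
    also have "\<dots> = (\<Prod>k\<in>K2. epow (f' k (restrict x (S' k))) (\<alpha> k)) *
                (\<integral>\<^sup>+y. (\<Prod>k\<in>K1. epow (f k ((restrict x (S' k))(j := y))) (\<alpha> k)) \<partial>M j)"
      using m by (intro nn_integral_cmult) auto
    also have "\<dots> \<le> (\<Prod>k\<in>K2. epow (f' k (restrict x (S' k))) (\<alpha> k)) *
        (\<Prod>k\<in>K1. epow (\<integral>\<^sup>+y. f k ((restrict x (S' k))(j := y)) \<partial>M j) (\<alpha> k))"
      using m \<alpha>(2)[of j] \<alpha>(1) KK(3)
      by (intro mult_left_mono nn_integral_prod_epow_le) (auto simp: K1_def)
    also have "(\<Prod>k\<in>K1. epow (\<integral>\<^sup>+y. f k ((restrict x (S' k))(j := y)) \<partial>M j) (\<alpha> k))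
        = (\<Prod>k\<in>K1. epow (f' k (restrict x (S' k))) (\<alpha> k))"
      by (intro prod.cong refl) (auto simp: K1_def f'_def)
    also have "(\<Prod>k\<in>K2. epow (f' k (restrict x (S' k))) (\<alpha> k)) *
          (\<Prod>k\<in>K1. epow (f' k (restrict x (S' k))) (\<alpha> k))
        = (\<Prod>k\<in>K. epow (f' k (restrict x (S' k))) (\<alpha> k))"
      by (subst KK(1), subst prod.union_disjoint[OF KK(3,4,2)]) (rule mult.commute)
    finally show ?thesis .
  qed
  have meas: "(\<lambda>x. \<Prod>k\<in>K. epow (f k (restrict x (S k))) (\<alpha> k)) \<in> borel_measurable (Pi\<^sub>M (insert j I) M)"
  proof (intro borel_measurable_prod_ennreal borel_measurable_epow)
    fix k assume k: "k \<in> K"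
    show "(\<lambda>x. f k (restrict x (S k))) \<in> borel_measurable (Pi\<^sub>M (insert j I) M)"
      using insert.prems(2)[OF k] fm[OF k] by (intro measurable_compose[OF measurable_restrict_subset])
  qed
  have "(\<integral>\<^sup>+x. (\<Prod>k\<in>K. epow (f k (restrict x (S k))) (\<alpha> k)) \<partial>Pi\<^sub>M (insert j I) M)
      = (\<integral>\<^sup>+x. \<integral>\<^sup>+y. (\<Prod>k\<in>K. epow (f k (restrict (x(j := y)) (S k))) (\<alpha> k)) \<partial>M j \<partial>Pi\<^sub>M I M)"
    by (rule product_nn_integral_insert[OF insert.hyps meas])
  also have "\<dots> \<le> (\<integral>\<^sup>+x. (\<Prod>k\<in>K. epow (f' k (restrict x (S' k))) (\<alpha> k)) \<partial>Pi\<^sub>M I M)"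
    by (intro nn_integral_mono inner)
  also have "\<dots> \<le> (\<Prod>k\<in>K. epow (\<integral>\<^sup>+x. f' k x \<partial>Pi\<^sub>M (S' k) M) (\<alpha> k))"
  proof (rule insert.IH)
    show "S' k \<subseteq> I" if "k \<in> K" for k using insert.prems(2)[OF that] by (auto simp: S'_def)
    show "(\<Sum>k | k \<in> K \<and> i \<in> S' k. \<alpha> k) = 1" if "i \<in> I" for i
    proof -
      have "i \<noteq> j" using that insert.hyps by auto
      then have "{k. k \<in> K \<and> i \<in> S' k} = {k. k \<in> K \<and> i \<in> S k}" by (auto simp: S'_def)
      then show ?thesis using insert.prems(4)[of i] that by simp
    qed
  qed (use K \<alpha> f'm in auto)
  finally show ?case by (simp only: intf' cong: prod.cong)
qed

text \<open>
The form in which Hoelder's inequality is applied to the scale, where integrals are only known through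
upper bounds.
\<close>
lemma nn_integral_powr_mult_le:
  fixes F G :: "'a \<Rightarrow> real"
  assumes [measurable]: "F \<in> borel_measurable M" "G \<in> borel_measurable M"
    and nonneg: "\<And>x. F x \<ge> 0" "\<And>x. G x \<ge> 0"
    and A: "(\<integral>\<^sup>+x. ennreal (F x) \<partial>M) \<le> ennreal A" "A \<ge> 0"
    and B: "(\<integral>\<^sup>+x. ennreal (G x) \<partial>M) \<le> ennreal B" "B \<ge> 0"
    and \<alpha>: "0 < \<alpha>" "\<alpha> < 1"
  shows "(\<integral>\<^sup>+x. ennreal (F x powr \<alpha> * G x powr (1 - \<alpha>)) \<partial>M)
          \<le> ennreal (A powr \<alpha> * B powr (1 - \<alpha>))"
proof -
  define f where "f k x = ennreal (if k then F x else G x)" for k x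
  define e where "e k = (if k then \<alpha> else 1 - \<alpha>)" for k
  have "(\<integral>\<^sup>+x. ennreal (F x powr \<alpha> * G x powr (1 - \<alpha>)) \<partial>M)
      = (\<integral>\<^sup>+x. (\<Prod>k\<in>UNIV. epow (f k x) (e k)) \<partial>M)"
    by (intro nn_integral_cong) (simp add: f_def e_def UNIV_bool epow_ennreal nonneg ennreal_mult mult.commute)
  also have "\<dots> \<le> (\<Prod>k\<in>UNIV. epow (\<integral>\<^sup>+x. f k x \<partial>M) (e k))"
    using \<alpha> by (intro nn_integral_prod_epow_le) (auto simp: e_def UNIV_bool f_def)
  also have "\<dots> = epow (\<integral>\<^sup>+x. ennreal (F x) \<partial>M) \<alpha> * epow (\<integral>\<^sup>+x. ennreal (G x) \<partial>M) (1 - \<alpha>)"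
    by (simp add: f_def e_def UNIV_bool mult.commute)
  also have "\<dots> \<le> epow (ennreal A) \<alpha> * epow (ennreal B) (1 - \<alpha>)"
    using \<alpha> A B by (intro mult_mono epow_mono) auto
  also have "\<dots> = ennreal (A powr \<alpha> * B powr (1 - \<alpha>))"
    using A B by (simp add: epow_ennreal ennreal_mult)
  finally show ?thesis .
qed

text \<open>
If \<open>w\<close> is bounded at every point by the integral of \<open>H\<close> along each coordinate line through that point,
then \<open>w\<close> to the power \<open>n / (n - 1)\<close> is at most a product of \<open>n\<close> factors of exponent \<open>1 / (n - 1)\<close>, the one
for direction \<open>b\<close> being independent of coordinate \<open>b\<close>. Each coordinate is seen by \<open>n - 1\<close> of them, so
Finner's inequality applies.
\<close>
lemma gagliardo_nirenberg_nn_integral: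
  fixes w H :: "'a::euclidean_space \<Rightarrow> ennreal"
  defines "n \<equiv> real DIM('a)"
  assumes n: "DIM('a) \<ge> 2"
    and H [measurable]: "H \<in> borel_measurable borel"
    and w [measurable]: "w \<in> borel_measurable borel"
    and le: "\<And>x b. b \<in> Basis \<Longrightarrow> w x \<le> (\<integral>\<^sup>+t. H (x + (t - x \<bullet> b) *\<^sub>R b) \<partial>lborel)"
  shows "(\<integral>\<^sup>+x. epow (w x) (n / (n - 1)) \<partial>lborel) \<le> epow (\<integral>\<^sup>+x. H x \<partial>lborel) (n / (n - 1))"
proof -
  define P where "P I = (\<Pi>\<^sub>M b\<in>I. (lborel :: real measure))" for I :: "'a set"
  define T where "T f = (\<Sum>b\<in>Basis. f b *\<^sub>R b)" for f :: "'a \<Rightarrow> real"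
  interpret product_sigma_finite "\<lambda>_::'a. lborel :: real measure" ..
  have lb: "(lborel :: 'a measure) = distr (P Basis) borel T"
    unfolding P_def T_def by (rule lborel_eq)
  have [measurable]: "T \<in> measurable (P Basis) borel"
    unfolding T_def P_def by measurable
  have nni: "(\<integral>\<^sup>+x. g x \<partial>lborel) = (\<integral>\<^sup>+f. g (T f) \<partial>P Basis)"
    if [measurable]: "g \<in> borel_measurable borel" for g :: "'a \<Rightarrow> ennreal"
    by (simp add: lb nn_integral_distr)
  have T_upd: "T (f(b := t)) = T f + (t - T f \<bullet> b) *\<^sub>R b" if "b \<in> Basis" for f b t
  proof -
    have "T (f(b := t)) = t *\<^sub>R b + (\<Sum>c\<in>Basis - {b}. f c *\<^sub>R c)"
      using that unfolding T_def by (subst sum.remove[of _ b]) (auto intro!: sum.cong)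
    moreover have "T f = f b *\<^sub>R b + (\<Sum>c\<in>Basis - {b}. f c *\<^sub>R c)"
      using that unfolding T_def by (subst sum.remove[of _ b]) auto
    moreover have "T f \<bullet> b = f b"
      using that by (simp add: T_def)
    ultimately show ?thesis by (simp add: algebra_simps)
  qed
  \<comment> \<open>The integral of \<open>H\<close> along the line in direction \<open>b\<close>, as a function of the other coordinates.\<close>
  define f where "f b z = (\<integral>\<^sup>+t. H (T (z(b := t))) \<partial>lborel)" for b z
  have ins: "insert b (Basis - {b}) = Basis" if "b \<in> Basis" for b :: 'a using that by auto
  have HT [measurable]: "(\<lambda>x. H (T x)) \<in> borel_measurable (P Basis)" by measurable
  have fm: "f b \<in> borel_measurable (P (Basis - {b}))" if b: "b \<in> Basis" for b
  proof -
    have [measurable]: "(\<lambda>x. H (T x)) \<in> borel_measurable (Pi\<^sub>M (insert b (Basis - {b})) (\<lambda>_. lborel))"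
      unfolding ins[OF b] using HT by (simp add: P_def)
    show ?thesis unfolding f_def P_def by measurable
  qed
  have fint: "(\<integral>\<^sup>+z. f b z \<partial>P (Basis - {b})) = (\<integral>\<^sup>+x. H x \<partial>lborel)" if b: "b \<in> Basis" for b
  proof -
    have "(\<lambda>x. H (T x)) \<in> borel_measurable (Pi\<^sub>M (insert b (Basis - {b})) (\<lambda>_. lborel))"
      unfolding ins[OF b] using HT by (simp add: P_def)
    from product_nn_integral_insert[OF _ _ this]
    have "(\<integral>\<^sup>+x. H (T x) \<partial>P Basis) = (\<integral>\<^sup>+z. f b z \<partial>P (Basis - {b}))"
      unfolding ins[OF b] by (simp add: f_def P_def)
    then show ?thesis using nni[OF H] by simp
  qed
  have card: "(\<Sum>k | k \<in> Basis \<and> i \<in> Basis - {k}. 1 / (n - 1)) = 1" if "i \<in> Basis" for i :: 'a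
  proof -
    have "{k. k \<in> Basis \<and> i \<in> Basis - {k}} = Basis - {i}" using that by auto
    then show ?thesis using that n by (simp add: n_def of_nat_diff)
  qed
  have "(\<integral>\<^sup>+x. epow (w x) (n / (n - 1)) \<partial>lborel) = (\<integral>\<^sup>+x. epow (w (T x)) (n / (n - 1)) \<partial>P Basis)"
    by (subst nni) auto
  also have "\<dots> \<le> (\<integral>\<^sup>+x. (\<Prod>b\<in>Basis. epow (f b (restrict x (Basis - {b}))) (1 / (n - 1))) \<partial>P Basis)"
  proof (intro nn_integral_mono)
    fix x assume x: "x \<in> space (P Basis)"
    have "epow (w (T x)) (n / (n - 1)) = (\<Prod>b\<in>(Basis :: 'a set). epow (w (T x)) (1 / (n - 1)))"
      by (subst prod_epow_same) (auto simp: n_def)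
    also have "\<dots> \<le> (\<Prod>b\<in>Basis. epow (f b (restrict x (Basis - {b}))) (1 / (n - 1)))"
    proof (intro prod_mono_ennreal epow_mono)
      fix b :: 'a assume b: "b \<in> Basis"
      have "(restrict x (Basis - {b}))(b := t) = x(b := t)" for t
        using x by (auto simp: fun_eq_iff P_def space_PiM PiE_def extensional_def)
      then show "w (T x) \<le> f b (restrict x (Basis - {b}))"
        using le[OF b, of "T x"] by (simp add: f_def T_upd[OF b])
    qed (use n in \<open>auto simp: n_def\<close>)
    finally show "epow (w (T x)) (n / (n - 1)) \<le> (\<Prod>b\<in>Basis. epow (f b (restrict x (Basis - {b}))) (1 / (n - 1)))" .
  qed
  also have "\<dots> \<le> (\<Prod>b\<in>Basis. epow (\<integral>\<^sup>+z. f b z \<partial>P (Basis - {b})) (1 / (n - 1)))"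
    unfolding P_def
  proof (intro finner_inequality)
    show "0 < 1 / (n - 1)" using n by (simp add: n_def)
  qed (use fm card in \<open>auto simp del: sum_constant simp: P_def\<close>)
  also have "\<dots> = (\<Prod>b\<in>(Basis :: 'a set). epow (\<integral>\<^sup>+x. H x \<partial>lborel) (1 / (n - 1)))"
    by (intro prod.cong) (auto simp: fint)
  also have "\<dots> = epow (\<integral>\<^sup>+x. H x \<partial>lborel) (n / (n - 1))"
    by (subst prod_epow_same) (auto simp: n_def)
  finally show ?thesis .
qed

lemma abs_diff_le_nn_integral_deriv:
  fixes f f' :: "real \<Rightarrow> real"
  assumes deriv: "\<And>t. (f has_real_derivative f' t) (at t)"
    and cont: "continuous_on UNIV f'"
    and "a \<le> b"
  shows "ennreal \<bar>f b - f a\<bar> \<le> (\<integral>\<^sup>+t. ennreal \<bar>f' t\<bar> * indicator {a..b} t \<partial>lborel)"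
proof -
  have *: "has_bochner_integral lborel (\<lambda>x. indicator {a..b} x *\<^sub>R f' x) (f b - f a)"
    using assms(3) deriv continuous_on_subset[OF cont]
    by (intro has_bochner_integral_FTC_Icc)
       (auto simp: has_real_derivative_iff_has_vector_derivative[symmetric] intro: DERIV_subset)
  have "ennreal (norm (f b - f a)) = ennreal (norm (\<integral>x. indicator {a..b} x *\<^sub>R f' x \<partial>lborel))"
    using * by (simp add: has_bochner_integral_iff)
  also have "\<dots> \<le> (\<integral>\<^sup>+x. ennreal (norm (indicator {a..b} x *\<^sub>R f' x)) \<partial>lborel)"
    using * by (intro integral_norm_bound_ennreal) (simp add: has_bochner_integral_iff)
  also have "\<dots> = (\<integral>\<^sup>+t. ennreal \<bar>f' t\<bar> * indicator {a..b} t \<partial>lborel)"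
    by (intro nn_integral_cong) (auto simp: indicator_def)
  finally show ?thesis by simp
qed

text \<open>
The signed power is used in place of \<open>\<bar>s\<bar> powr \<gamma>\<close> because its derivative carries no sign, so that
taking absolute values in the fundamental theorem of calculus loses nothing.
\<close>
lemma has_real_derivative_signed_powr:
  fixes s \<gamma> :: real
  assumes "\<gamma> > 1"
  shows "((\<lambda>s. s * \<bar>s\<bar> powr (\<gamma> - 1)) has_real_derivative \<gamma> * \<bar>s\<bar> powr (\<gamma> - 1)) (at s)"
proof -
  consider "s > 0" | "s < 0" | "s = 0" by linarith
  then show ?thesis
  proof cases
    case 1
    have *: "((\<lambda>s. s powr \<gamma>) has_real_derivative \<gamma> * s powr (\<gamma> - 1)) (at s)"
      using 1 by (auto intro!: derivative_eq_intros)
    have "eventually (\<lambda>s. s * \<bar>s\<bar> powr (\<gamma> - 1) = s powr \<gamma>) (nhds s)"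
      using eventually_nhds_in_open[of "{0<..}" s] 1
      by (auto elim!: eventually_mono simp: powr_mult_base)
    with * 1 show ?thesis by (subst DERIV_cong_ev[OF refl _ refl]) auto
  next
    case 2
    have *: "((\<lambda>s. - ((- s) powr \<gamma>)) has_real_derivative \<gamma> * (- s) powr (\<gamma> - 1)) (at s)"
      using 2 by (auto intro!: derivative_eq_intros)
    have "eventually (\<lambda>s. s * \<bar>s\<bar> powr (\<gamma> - 1) = - ((- s) powr \<gamma>)) (nhds s)"
      using eventually_nhds_in_open[OF open_lessThan, of s 0, simplified, OF 2]
    proof (rule eventually_mono)
      fix x :: real assume "x < 0"
      then have "(- x) * (- x) powr (\<gamma> - 1) = (- x) powr \<gamma>"
        by (subst powr_mult_base) auto
      with \<open>x < 0\<close> show "x * \<bar>x\<bar> powr (\<gamma> - 1) = - ((- x) powr \<gamma>)" by simp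
    qed
    with * 2 show ?thesis by (subst DERIV_cong_ev[OF refl _ refl]) auto
  next
    case 3
    have "((\<lambda>h::real. \<bar>h\<bar> powr (\<gamma> - 1)) \<longlongrightarrow> \<bar>0\<bar> powr (\<gamma> - 1)) (at 0)"
      using assms by (intro tendsto_powr' tendsto_intros) auto
    then have "((\<lambda>h::real. \<bar>h\<bar> powr (\<gamma> - 1)) \<longlongrightarrow> 0) (at 0)" by simp
    then have "((\<lambda>h::real. (h * \<bar>h\<bar> powr (\<gamma> - 1)) / h) \<longlongrightarrow> 0) (at 0)"
      by (rule Lim_transform_eventually) (auto simp: eventually_at_filter)
    then show ?thesis using 3 by (simp add: DERIV_def)
  qed
qed

section \<open>Size bounds in the unified scale\<close>

text \<open>
An upper bound \<open>K\<close> for the norm with reciprocal exponent \<open>s > - 1 / n\<close>, up to a constant factor when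
\<open>s < 0\<close>. Carrying a bound instead of a norm avoids all questions of finiteness in the
intermediate steps. The factor \<open>2\<close> in the Hoelder condition is there to make it an automatic
consequence of the supremum bound when \<open>s = 0\<close>; thus \<open>L\<^sup>\<infinity>\<close> is literally the limiting Hoelder space of
exponent \<open>0\<close>, and all \<open>s \<le> 0\<close> can be treated together.
\<close>
definition scale_le :: "real \<Rightarrow> ('a::euclidean_space \<Rightarrow> 'b::real_normed_vector) \<Rightarrow> real \<Rightarrow> bool" where
  "scale_le s v K \<longleftrightarrow> 0 \<le> K \<and>
     (if s > 0 then (\<integral>\<^sup>+x. ennreal (norm (v x) powr (1 / s)) \<partial>lborel) \<le> ennreal (K powr (1 / s))
      else (\<forall>x. norm (v x) \<le> K) \<and>
           (\<forall>x y. norm (v x - v y) \<le> 2 * K * norm (x - y) powr (- (real DIM('a) * s))))"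

lemma scale_le_nonneg: "scale_le s v K \<Longrightarrow> 0 \<le> K"
  by (simp add: scale_le_def)

lemma has_real_derivative_along_line:
  fixes u :: "'a::euclidean_space \<Rightarrow> real"
  assumes "\<And>x. (u has_derivative (\<lambda>h. G x \<bullet> h)) (at x)"
  shows "((\<lambda>t. u (x + t *\<^sub>R e)) has_real_derivative G (x + t *\<^sub>R e) \<bullet> e) (at t)"
proof -
  have "((\<lambda>t. x + t *\<^sub>R e) has_derivative (\<lambda>t. t *\<^sub>R e)) (at t)"
    by (auto intro!: derivative_eq_intros)
  from has_derivative_compose[OF this assms[of "x + t *\<^sub>R e"]]
  show ?thesis by (simp add: has_field_derivative_def o_def mult.commute[of _ "G (x + t *\<^sub>R e) \<bullet> e"])
qed

section \<open>The Sobolev inequality\<close>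

text \<open>
The fundamental theorem of calculus along a coordinate line, started at a point outside the support
of \<open>u\<close>. The function \<open>\<Phi>\<close> makes room for powers of \<open>u\<close>.
\<close>
lemma abs_le_line_integral:
  fixes u :: "'a::euclidean_space \<Rightarrow> real"
  assumes deriv: "\<And>x. (u has_derivative (\<lambda>h. G x \<bullet> h)) (at x)"
    and G: "continuous_on UNIV G"
    and supp: "\<And>x. u x \<noteq> 0 \<Longrightarrow> norm x \<le> R"
    and \<Phi>: "\<And>s. (\<Phi> has_real_derivative \<phi> s) (at s)" and \<phi>: "continuous_on UNIV \<phi>" and 0: "\<Phi> 0 = 0"
    and b: "b \<in> Basis"
  shows "ennreal \<bar>\<Phi> (u x)\<bar> \<le> (\<integral>\<^sup>+t. (\<lambda>y. ennreal (\<bar>\<phi> (u y)\<bar> * norm (G y))) (x + (t - x \<bullet> b) *\<^sub>R b) \<partial>lborel)"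
proof -
  define y where "y t = x + (t - x \<bullet> b) *\<^sub>R b" for t
  have y: "y t = (x - (x \<bullet> b) *\<^sub>R b) + t *\<^sub>R b" for t by (simp add: y_def algebra_simps)
  have [continuous_intros]: "continuous_on UNIV y" unfolding y_def by (intro continuous_intros)
  have u: "continuous_on UNIV u"
    using has_derivative_continuous[OF deriv] by (simp add: continuous_on_eq_continuous_at)
  have d: "((\<lambda>t. \<Phi> (u (y t))) has_real_derivative \<phi> (u (y t)) * (G (y t) \<bullet> b)) (at t)" for t
    unfolding y by (rule DERIV_chain2[OF \<Phi> has_real_derivative_along_line[OF deriv]])
  have cont: "continuous_on UNIV (\<lambda>t. \<phi> (u (y t)) * (G (y t) \<bullet> b))"
    by (intro continuous_intros continuous_on_compose2[OF \<phi>] continuous_on_compose2[OF u]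
          continuous_on_compose2[OF G]) auto
  \<comment> \<open>The point with \<open>b\<close>-coordinate \<open>a\<close> has norm greater than \<open>R\<close>, and \<open>a\<close> lies to the left of \<open>x \<bullet> b\<close>.\<close>
  define a where "a = min (x \<bullet> b) (- (\<bar>R\<bar> + 1))"
  have "y a \<bullet> b = a" using b by (simp add: y_def inner_add_left)
  then have "norm (y a) \<ge> \<bar>a\<bar>" using Basis_le_norm[OF b, of "y a"] by simp
  then have "u (y a) = 0" using supp[of "y a"] by (force simp: a_def)
  moreover have "y (x \<bullet> b) = x" by (simp add: y_def)
  ultimately have "ennreal \<bar>\<Phi> (u x)\<bar>
      \<le> (\<integral>\<^sup>+t. ennreal \<bar>\<phi> (u (y t)) * (G (y t) \<bullet> b)\<bar> * indicator {a..x \<bullet> b} t \<partial>lborel)"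
    using abs_diff_le_nn_integral_deriv[OF d cont, of a "x \<bullet> b"] 0 by (simp add: a_def)
  also have "\<dots> \<le> (\<integral>\<^sup>+t. ennreal (\<bar>\<phi> (u (y t))\<bar> * norm (G (y t))) \<partial>lborel)"
  proof (intro nn_integral_mono)
    fix t
    have "\<bar>G (y t) \<bullet> b\<bar> \<le> norm (G (y t))" by (rule Basis_le_norm[OF b])
    then show "ennreal \<bar>\<phi> (u (y t)) * (G (y t) \<bullet> b)\<bar> * indicator {a..x \<bullet> b} t
        \<le> ennreal (\<bar>\<phi> (u (y t))\<bar> * norm (G (y t)))"
      by (auto simp: indicator_def abs_mult intro!: ennreal_leI mult_left_mono)
  qed
  finally show ?thesis by (simp add: y_def)
qed

lemma nn_integral_bounded_support_finite:
  fixes v :: "'a::euclidean_space \<Rightarrow> real"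
  assumes "\<And>x. v x \<noteq> 0 \<Longrightarrow> norm x \<le> R" "\<And>x. v x \<le> M"
  shows "(\<integral>\<^sup>+x. ennreal (v x) \<partial>lborel) < \<infinity>"
proof -
  have "(\<integral>\<^sup>+x. ennreal (v x) \<partial>lborel) \<le> (\<integral>\<^sup>+x. ennreal M * indicator (cball (0::'a) R) x \<partial>lborel)"
  proof (intro nn_integral_mono)
    fix x :: 'a show "ennreal (v x) \<le> ennreal M * indicator (cball 0 R) x"
      using assms(1)[of x] assms(2)[of x] by (cases "v x = 0") (auto simp: indicator_def intro!: ennreal_leI)
  qed
  also have "\<dots> = ennreal M * emeasure lborel (cball (0::'a) R)"
    by (subst nn_integral_cmult_indicator) auto
  also have "\<dots> < \<infinity>"
    using emeasure_bounded_finite[of "cball (0::'a) R"] by (simp add: ennreal_mult_less_top)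
  finally show ?thesis .
qed

lemma bounded_support_continuous_bounded:
  fixes v :: "'a::euclidean_space \<Rightarrow> 'b::real_normed_vector"
  assumes "continuous_on UNIV v" "\<And>x. v x \<noteq> 0 \<Longrightarrow> norm x \<le> R"
  obtains M where "M > 0" "\<And>x. norm (v x) \<le> M"
proof -
  have "compact (v ` cball 0 R)"
    by (intro compact_continuous_image continuous_on_subset[OF assms(1)]) auto
  then obtain M where M: "M > 0" "\<And>y. y \<in> v ` cball 0 R \<Longrightarrow> norm y \<le> M"
    using compact_imp_bounded bounded_pos by metis
  have "norm (v x) \<le> M" for x
    using M assms(2)[of x] by (cases "v x = 0") auto
  with M(1) that show thesis by blast
qed

text \<open>
Here \<open>s = 1 / p\<close> with \<open>1 \<le> p < n\<close>. Gagliardo's inequality for \<open>w = \<bar>u\<bar>\<close> is the case \<open>p = 1\<close>. For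
\<open>p > 1\<close> it is applied to \<open>w = \<bar>u\<bar> powr \<gamma>\<close>, whose gradient has \<open>\<gamma> \<bar>u\<bar> powr (\<gamma> - 1)\<close> times the length of \<open>G\<close>,
and Hoelder's inequality separates the two factors. The exponent \<open>\<gamma>\<close> is the one for which both
powers of \<open>u\<close> that arise are the critical power \<open>q\<close>; the integral \<open>J\<close> of \<open>\<bar>u\<bar> powr q\<close>, which is
finite since \<open>u\<close> is bounded with bounded support, then occurs on both sides and can be divided out.
\<close>
lemma sobolev_inequality:
  fixes u :: "'a::euclidean_space \<Rightarrow> real"
  defines "n \<equiv> real DIM('a)"
  assumes n: "DIM('a) \<ge> 2"
    and deriv: "\<And>x. (u has_derivative (\<lambda>h. G x \<bullet> h)) (at x)"
    and G: "continuous_on UNIV G"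
    and supp: "\<And>x. u x \<noteq> 0 \<Longrightarrow> norm x \<le> R"
    and s: "1 / n < s" "s \<le> 1"
    and le: "scale_le s G A"
  shows "scale_le (s - 1 / n) u ((n - 1) / (n * s - 1) * A)"
proof -
  have n2: "n \<ge> 2" using n by (simp add: n_def)
  have ns: "n * s > 1" using s n2 by (simp add: field_simps)
  have s0: "s > 0" using s n2 by (smt (verit) divide_nonneg_nonneg)
  have A0: "A \<ge> 0" using le by (rule scale_le_nonneg)
  have GA: "(\<integral>\<^sup>+x. ennreal (norm (G x) powr (1 / s)) \<partial>lborel) \<le> ennreal (A powr (1 / s))"
    using le s0 by (simp add: scale_le_def)
  have u: "continuous_on UNIV u"
    using has_derivative_continuous[OF deriv] by (simp add: continuous_on_eq_continuous_at)
  have [measurable]: "u \<in> borel_measurable borel" "G \<in> borel_measurable borel"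
    using u G by (auto intro: borel_measurable_continuous_onI)
  define \<gamma> where "\<gamma> = (n - 1) / (n * s - 1)"
  define q where "q = n / (n * s - 1)"
  have q: "1 / (s - 1 / n) = q" "q > 0" using n2 ns by (auto simp: q_def field_simps)
  have \<gamma>0: "\<gamma> > 0" using n2 ns by (simp add: \<gamma>_def)
  have \<gamma>q: "\<gamma> * (n / (n - 1)) = q" using n2 ns by (simp add: \<gamma>_def q_def)
  then have \<gamma>q': "\<gamma> * n / (n - 1) = q" by simp
  have "(\<integral>\<^sup>+x. ennreal (\<bar>u x\<bar> powr q) \<partial>lborel) \<le> ennreal ((\<gamma> * A) powr q)"
  proof (cases "s = 1")
    case True
    have \<gamma>1: "\<gamma> = 1" using True n2 by (simp add: \<gamma>_def)
    have "(\<integral>\<^sup>+x. ennreal (\<bar>u x\<bar> powr q) \<partial>lborel) = (\<integral>\<^sup>+x. epow (ennreal \<bar>u x\<bar>) (n / (n - 1)) \<partial>lborel)"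
      using \<gamma>q by (simp add: epow_ennreal \<gamma>1)
    also have "\<dots> \<le> epow (\<integral>\<^sup>+x. ennreal (norm (G x)) \<partial>lborel) (n / (n - 1))"
      unfolding n_def
    proof (intro gagliardo_nirenberg_nn_integral n)
      fix x b :: 'a assume b: "b \<in> Basis"
      show "ennreal \<bar>u x\<bar> \<le> (\<integral>\<^sup>+t. ennreal (norm (G (x + (t - x \<bullet> b) *\<^sub>R b))) \<partial>lborel)"
        using abs_le_line_integral[where \<Phi> = "\<lambda>s. s" and \<phi> = "\<lambda>_. 1" and x = x, OF deriv G supp _ _ _ b]
        by simp
    qed auto
    also have "\<dots> \<le> epow (ennreal A) (n / (n - 1))"
      using GA A0 True n2 by (intro epow_mono) auto
    finally show ?thesis using A0 \<gamma>q by (simp add: epow_ennreal \<gamma>1)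
  next
    case False
    then have s1: "s < 1" using s by simp
    have \<gamma>1: "\<gamma> > 1" using ns s1 n2 by (simp add: \<gamma>_def field_simps)
    obtain M where M: "M > 0" "\<And>x. norm (u x) \<le> M"
      using bounded_support_continuous_bounded[OF u supp] by blast
    have "(\<integral>\<^sup>+x. ennreal (\<bar>u x\<bar> powr q) \<partial>lborel) < \<infinity>"
      using M q supp by (intro nn_integral_bounded_support_finite[of _ R "M powr q"]) (auto intro!: powr_mono2)
    then obtain J where J: "(\<integral>\<^sup>+x. ennreal (\<bar>u x\<bar> powr q) \<partial>lborel) = ennreal J" "J \<ge> 0"
      by (cases "\<integral>\<^sup>+x. ennreal (\<bar>u x\<bar> powr q) \<partial>lborel") auto
    let ?H = "\<lambda>x. ennreal (\<bar>\<gamma> * \<bar>u x\<bar> powr (\<gamma> - 1)\<bar> * norm (G x))"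
    have eq: "q * (1 - s) = \<gamma> - 1" using ns by (simp add: q_def \<gamma>_def field_simps)
    have "ennreal J = (\<integral>\<^sup>+x. epow (ennreal \<bar>u x * \<bar>u x\<bar> powr (\<gamma> - 1)\<bar>) (n / (n - 1)) \<partial>lborel)"
      unfolding J(1)[symmetric]
      by (intro nn_integral_cong)
         (simp add: epow_ennreal abs_mult powr_mult_base powr_powr \<gamma>q')
    also have "\<dots> \<le> epow (\<integral>\<^sup>+x. ?H x \<partial>lborel) (n / (n - 1))"
      unfolding n_def
    proof (intro gagliardo_nirenberg_nn_integral n)
      fix x b :: 'a assume b: "b \<in> Basis"
      have "continuous_on UNIV (\<lambda>s. \<gamma> * \<bar>s\<bar> powr (\<gamma> - 1))"
        using \<gamma>1 by (intro continuous_intros continuous_on_powr') auto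
      from abs_le_line_integral[OF deriv G supp has_real_derivative_signed_powr[OF \<gamma>1] this _ b, where x = x]
      show "ennreal \<bar>u x * \<bar>u x\<bar> powr (\<gamma> - 1)\<bar> \<le> (\<integral>\<^sup>+t. ?H (x + (t - x \<bullet> b) *\<^sub>R b) \<partial>lborel)"
        by simp
    qed auto
    also have "(\<integral>\<^sup>+x. ?H x \<partial>lborel)
        = ennreal \<gamma> * (\<integral>\<^sup>+x. ennreal ((norm (G x) powr (1 / s)) powr s * (\<bar>u x\<bar> powr q) powr (1 - s)) \<partial>lborel)"
      using \<gamma>0 s0 eq
      by (subst nn_integral_cmult[symmetric])
         (auto simp: powr_powr ennreal_mult[symmetric] abs_mult mult_ac intro!: nn_integral_cong)
    also have "epow \<dots> (n / (n - 1)) \<le> epow (ennreal \<gamma> * ennreal ((A powr (1 / s)) powr s * J powr (1 - s))) (n / (n - 1))"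
      using n2 s0 s1 GA J A0
      by (intro epow_mono mult_left_mono nn_integral_powr_mult_le) auto
    also have "\<dots> = ennreal ((\<gamma> * A) powr (n / (n - 1)) * J powr ((1 - s) * (n / (n - 1))))"
      using \<gamma>0 A0 s0 by (simp add: powr_powr ennreal_mult[symmetric] epow_ennreal powr_mult mult.assoc)
    \<comment> \<open>The power of \<open>J\<close> on the right is smaller than \<open>1\<close>, so it can be absorbed on the left.\<close>
    finally have main: "J \<le> (\<gamma> * A) powr (n / (n - 1)) * J powr ((1 - s) * (n / (n - 1)))"
      by (simp add: ennreal_le_iff)
    have "J \<le> (\<gamma> * A) powr q"
    proof (cases "J = 0")
      case False
      then have J0: "J > 0" using J by simp
      have e: "(n * s - 1) / (n - 1) = 1 - (1 - s) * (n / (n - 1))" using n2 by (simp add: field_simps)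
      have "J powr ((n * s - 1) / (n - 1)) = J / J powr ((1 - s) * (n / (n - 1)))"
        unfolding e powr_diff using J0 by simp
      also have "\<dots> \<le> (\<gamma> * A) powr (n / (n - 1))"
        using main J0 by (simp add: field_simps)
      finally have h: "(J powr ((n * s - 1) / (n - 1))) powr \<gamma> \<le> ((\<gamma> * A) powr (n / (n - 1))) powr \<gamma>"
        using \<gamma>0 by (intro powr_mono2) auto
      have e1: "(n * s - 1) / (n - 1) * \<gamma> = 1" using n2 ns by (simp add: \<gamma>_def)
      have e2: "n / (n - 1) * \<gamma> = q" using \<gamma>q by (simp add: mult.commute)
      show ?thesis using h J0 unfolding powr_powr e1 e2 by simp
    qed simp
    then show ?thesis by (simp add: J ennreal_leI)
  qed
  moreover have "s - 1 / n > 0" using s by simp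
  ultimately show ?thesis
    using q \<gamma>0 A0 by (simp add: scale_le_def flip: \<gamma>_def)
qed

lemma nn_integral_lborel_affine:
  fixes h :: "'a::euclidean_space \<Rightarrow> ennreal"
  assumes [measurable]: "h \<in> borel_measurable borel" and t: "t > 0"
  shows "(\<integral>\<^sup>+z. h (a + t *\<^sub>R z) \<partial>lborel) = ennreal (t powr (- real DIM('a))) * (\<integral>\<^sup>+z. h z \<partial>lborel)"
proof -
  have "(\<integral>\<^sup>+z. h z \<partial>lborel)
      = (\<integral>\<^sup>+z. h z \<partial>density (distr lborel borel (\<lambda>z. a + t *\<^sub>R z)) (\<lambda>_. ennreal (\<bar>t\<bar> ^ DIM('a))))"
    using lborel_affine[of t a] t by simp
  also have "\<dots> = ennreal (t ^ DIM('a)) * (\<integral>\<^sup>+z. h (a + t *\<^sub>R z) \<partial>lborel)"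
    using t by (simp add: nn_integral_density nn_integral_distr nn_integral_cmult)
  finally have "ennreal (t powr (- real DIM('a))) * (\<integral>\<^sup>+z. h z \<partial>lborel)
      = (ennreal (t powr (- real DIM('a))) * ennreal (t ^ DIM('a))) * (\<integral>\<^sup>+z. h (a + t *\<^sub>R z) \<partial>lborel)"
    by (simp add: mult.assoc)
  also have "ennreal (t powr (- real DIM('a))) * ennreal (t ^ DIM('a)) = 1"
    using t by (simp add: ennreal_mult[symmetric] powr_minus powr_realpow)
  finally show ?thesis by simp
qed

lemma nn_integral_unit_interval_powr:
  fixes e :: real
  assumes "e < 1"
  shows "(\<integral>\<^sup>+t. ennreal (t powr (- e)) * indicator {0..1} t \<partial>lborel) = ennreal (1 / (1 - e))"
proof -
  have "((\<lambda>t::real. t powr (- e)) has_integral 1 / (1 - e)) {0..1}"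
    using has_integral_powr_from_0[of "- e" 1] assms by simp
  from nn_integral_has_integral_lebesgue'[OF _ this]
  show ?thesis by simp
qed

section \<open>The Morrey inequality\<close>

text \<open>
Along the segment from \<open>x\<close> to \<open>z\<close> the difference \<open>u z - u x\<close> is at most \<open>d\<close> times the integral of
\<open>norm (G (x + t (z - x)))\<close> over \<open>0 \<le> t \<le> 1\<close>. The order of integration is exchanged; for fixed \<open>t\<close>
Hoelder's inequality in \<open>z\<close> and the dilation by \<open>t\<close> give the factor \<open>t powr (- (n * s))\<close>, which is
integrable at \<open>0\<close> exactly because \<open>n * s < 1\<close>, that is \<open>p > n\<close>.
\<close>
lemma morrey_mean_oscillation:
  fixes u :: "'a::euclidean_space \<Rightarrow> real"
  defines "n \<equiv> real DIM('a)"
  assumes deriv: "\<And>x. (u has_derivative (\<lambda>h. G x \<bullet> h)) (at x)"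
    and G: "continuous_on UNIV G"
    and s: "0 < s" "s < 1 / n"
    and le: "scale_le s G A"
    and B: "B \<in> sets borel" "emeasure lborel B = ennreal V" "V \<ge> 0"
    and d: "\<And>z. z \<in> B \<Longrightarrow> norm (z - x) \<le> d" "d \<ge> 0"
  shows "(\<integral>\<^sup>+z. ennreal \<bar>u z - u x\<bar> * indicator B z \<partial>lborel)
          \<le> ennreal (d * A * V powr (1 - s) / (1 - n * s))"
proof -
  note [measurable] = B(1)
  have [measurable]: "G \<in> borel_measurable borel"
    using G by (auto intro: borel_measurable_continuous_onI)
  have n1: "n \<ge> 1" by (simp add: n_def DIM_positive Suc_leI)
  have s1: "s < 1" using s n1 by (smt (verit) divide_le_eq_1)
  have ns: "n * s < 1" using s n1 by (simp add: field_simps)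
  have A0: "A \<ge> 0" using le by (rule scale_le_nonneg)
  have GA: "(\<integral>\<^sup>+x. ennreal (norm (G x) powr (1 / s)) \<partial>lborel) \<le> ennreal (A powr (1 / s))"
    using le s by (simp add: scale_le_def)
  have slice: "(\<integral>\<^sup>+z. ennreal (norm (G (x + t *\<^sub>R (z - x)))) * indicator B z \<partial>lborel)
      \<le> ennreal (A * V powr (1 - s) * t powr (- (n * s)))" if t: "t > 0" for t
  proof -
    let ?F = "\<lambda>z. norm (G (x + t *\<^sub>R (z - x))) powr (1 / s)"
    have eq: "x + t *\<^sub>R (z - x) = (x - t *\<^sub>R x) + t *\<^sub>R z" for z by (simp add: algebra_simps)
    have "(\<integral>\<^sup>+z. ennreal (?F z) \<partial>lborel)
        = ennreal (t powr (- n)) * (\<integral>\<^sup>+z. ennreal (norm (G z) powr (1 / s)) \<partial>lborel)"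
      unfolding n_def eq using nn_integral_lborel_affine[OF _ t, of "\<lambda>z. ennreal (norm (G z) powr (1 / s))" "x - t *\<^sub>R x"]
      by simp
    also have "\<dots> \<le> ennreal (t powr (- n)) * ennreal (A powr (1 / s))"
      by (intro mult_left_mono GA) auto
    finally have F: "(\<integral>\<^sup>+z. ennreal (?F z) \<partial>lborel) \<le> ennreal (t powr (- n) * A powr (1 / s))"
      by (simp add: ennreal_mult)
    have "(\<integral>\<^sup>+z. ennreal (indicat_real B z) \<partial>lborel) \<le> ennreal V"
      by (simp add: ennreal_indicator B)
    with F have "(\<integral>\<^sup>+z. ennreal (?F z powr s * indicat_real B z powr (1 - s)) \<partial>lborel)
        \<le> ennreal ((t powr (- n) * A powr (1 / s)) powr s * V powr (1 - s))"
      using s s1 B(3) by (intro nn_integral_powr_mult_le) auto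
    also have "(t powr (- n) * A powr (1 / s)) powr s * V powr (1 - s) = A * V powr (1 - s) * t powr (- (n * s))"
      using s A0 t by (simp add: powr_mult powr_powr)
    also have "(\<integral>\<^sup>+z. ennreal (?F z powr s * indicat_real B z powr (1 - s)) \<partial>lborel)
        = (\<integral>\<^sup>+z. ennreal (norm (G (x + t *\<^sub>R (z - x)))) * indicator B z \<partial>lborel)"
      using s s1 by (intro nn_integral_cong) (auto simp: powr_powr indicator_def)
    finally show ?thesis .
  qed
  let ?K = "\<lambda>z t. ennreal (norm (G (x + t *\<^sub>R (z - x))) * d) * indicator {0..1} t * indicator B z"
  have "(\<integral>\<^sup>+z. ennreal \<bar>u z - u x\<bar> * indicator B z \<partial>lborel)
      \<le> (\<integral>\<^sup>+z. \<integral>\<^sup>+t. ?K z t \<partial>lborel \<partial>lborel)"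
  proof (intro nn_integral_mono)
    fix z
    show "ennreal \<bar>u z - u x\<bar> * indicator B z \<le> (\<integral>\<^sup>+t. ?K z t \<partial>lborel)"
    proof (cases "z \<in> B")
      case True
      have "continuous_on UNIV (\<lambda>t. G (x + t *\<^sub>R (z - x)) \<bullet> (z - x))"
        by (intro continuous_intros continuous_on_compose2[OF G]) auto
      from abs_diff_le_nn_integral_deriv[OF has_real_derivative_along_line[OF deriv] this, of 0 1]
      have "ennreal \<bar>u z - u x\<bar>
          \<le> (\<integral>\<^sup>+t. ennreal \<bar>G (x + t *\<^sub>R (z - x)) \<bullet> (z - x)\<bar> * indicator {0..1} t \<partial>lborel)"
        by simp
      also have "\<dots> \<le> (\<integral>\<^sup>+t. ?K z t \<partial>lborel)"
      proof (intro nn_integral_mono)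
        fix t
        have "\<bar>G (x + t *\<^sub>R (z - x)) \<bullet> (z - x)\<bar> \<le> norm (G (x + t *\<^sub>R (z - x))) * norm (z - x)"
          by (rule Cauchy_Schwarz_ineq2)
        also have "\<dots> \<le> norm (G (x + t *\<^sub>R (z - x))) * d"
          using d(1)[OF True] by (intro mult_left_mono) auto
        finally show "ennreal \<bar>G (x + t *\<^sub>R (z - x)) \<bullet> (z - x)\<bar> * indicator {0..1} t \<le> ?K z t"
          using True by (auto simp: indicator_def intro!: ennreal_leI)
      qed
      finally show ?thesis using True by simp
    qed simp
  qed
  also have "\<dots> = (\<integral>\<^sup>+t. \<integral>\<^sup>+z. ?K z t \<partial>lborel \<partial>lborel)"
    by (rule lborel_pair.Fubini') measurable
  also have "\<dots> \<le> (\<integral>\<^sup>+t. ennreal (d * A * V powr (1 - s)) * (ennreal (t powr (- (n * s))) * indicator {0..1} t) \<partial>lborel)"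
  proof (rule nn_integral_mono_AE)
    show "AE t in lborel. (\<integral>\<^sup>+z. ?K z t \<partial>lborel)
        \<le> ennreal (d * A * V powr (1 - s)) * (ennreal (t powr (- (n * s))) * indicator {0..1} t)"
      using AE_lborel_singleton[of "0::real"]
    proof eventually_elim
      fix t :: real assume "t \<noteq> 0"
      show "(\<integral>\<^sup>+z. ?K z t \<partial>lborel)
        \<le> ennreal (d * A * V powr (1 - s)) * (ennreal (t powr (- (n * s))) * indicator {0..1} t)"
      proof (cases "t \<in> {0..1}")
        case True
        have "(\<integral>\<^sup>+z. ?K z t \<partial>lborel)
            = (\<integral>\<^sup>+z. ennreal d * (ennreal (norm (G (x + t *\<^sub>R (z - x)))) * indicator B z) \<partial>lborel)"
          using True d by (intro nn_integral_cong) (simp add: ennreal_mult mult_ac)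
        also have "\<dots> = ennreal d * (\<integral>\<^sup>+z. ennreal (norm (G (x + t *\<^sub>R (z - x)))) * indicator B z \<partial>lborel)"
          by (rule nn_integral_cmult) measurable
        also have "\<dots> \<le> ennreal d * ennreal (A * V powr (1 - s) * t powr (- (n * s)))"
          using True \<open>t \<noteq> 0\<close> by (intro mult_left_mono slice) auto
        also have "\<dots> = ennreal (d * A * V powr (1 - s)) * (ennreal (t powr (- (n * s))) * indicator {0..1} t)"
          using True d A0 by (simp add: ennreal_mult[symmetric] mult_ac)
        finally show ?thesis .
      qed simp
    qed
  qed
  also have "\<dots> = ennreal (d * A * V powr (1 - s)) * ennreal (1 / (1 - n * s))"
    using ns by (subst nn_integral_cmult) (auto simp: nn_integral_unit_interval_powr)
  also have "\<dots> = ennreal (d * A * V powr (1 - s) / (1 - n * s))"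
    using ns d A0 by (subst ennreal_mult[symmetric]) auto
  finally show ?thesis .
qed

text \<open>
The values at \<open>x\<close> and \<open>y\<close> are both compared with the mean over the ball around \<open>x\<close> of radius
\<open>norm (x - y)\<close>. Its points are within one radius of \<open>x\<close> and within two of \<open>y\<close>, whence the constant \<open>3\<close>.
\<close>
lemma morrey_hoelder_estimate:
  fixes u :: "'a::euclidean_space \<Rightarrow> real"
  defines "n \<equiv> real DIM('a)"
  assumes deriv: "\<And>x. (u has_derivative (\<lambda>h. G x \<bullet> h)) (at x)"
    and G: "continuous_on UNIV G"
    and s: "0 < s" "s < 1 / n"
    and le: "scale_le s G A"
  shows "\<bar>u x - u y\<bar>
    \<le> 3 * unit_ball_vol n powr (- s) / (1 - n * s) * A * norm (x - y) powr (1 - n * s)"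
proof (cases "x = y")
  case False
  define \<rho> where "\<rho> = norm (x - y)"
  have \<rho>: "\<rho> > 0" using False by (simp add: \<rho>_def)
  have n1: "n \<ge> 1" by (simp add: n_def DIM_positive Suc_leI)
  have ns: "n * s < 1" using s n1 by (simp add: field_simps)
  have A0: "A \<ge> 0" using le by (rule scale_le_nonneg)
  have [measurable]: "u \<in> borel_measurable borel"
    using has_derivative_continuous[OF deriv]
    by (auto intro!: borel_measurable_continuous_onI simp: continuous_on_eq_continuous_at)
  define \<omega> where "\<omega> = unit_ball_vol n"
  have \<omega>: "\<omega> > 0" by (simp add: \<omega>_def n_def)
  define V where "V = \<omega> * \<rho> ^ DIM('a)"
  have V: "V > 0" using \<omega> \<rho> by (simp add: V_def)
  define B where "B = cball x \<rho>"
  have B: "B \<in> sets borel" "emeasure lborel B = ennreal V"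
    using \<rho> by (auto simp: B_def V_def \<omega>_def n_def emeasure_cball)
  let ?I = "\<lambda>d. d * A * V powr (1 - s) / (1 - n * s)"
  have 1: "(\<integral>\<^sup>+z. ennreal \<bar>u z - u x\<bar> * indicator B z \<partial>lborel) \<le> ennreal (?I \<rho>)"
    unfolding n_def using s V \<rho>
    by (intro morrey_mean_oscillation[OF deriv G _ _ le B])
       (auto simp: n_def B_def dist_norm norm_minus_commute)
  have 2: "(\<integral>\<^sup>+z. ennreal \<bar>u z - u y\<bar> * indicator B z \<partial>lborel) \<le> ennreal (?I (2 * \<rho>))"
    unfolding n_def
  proof (rule morrey_mean_oscillation[OF deriv G _ _ le B])
    fix z assume "z \<in> B"
    then show "norm (z - y) \<le> 2 * \<rho>"
      using norm_triangle_ineq[of "z - x" "x - y"] by (simp add: B_def dist_norm norm_minus_commute \<rho>_def)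
  qed (use s V \<rho> in \<open>auto simp: n_def\<close>)
  have "ennreal (\<bar>u x - u y\<bar> * V) = (\<integral>\<^sup>+z. ennreal \<bar>u x - u y\<bar> * indicator B z \<partial>lborel)"
    using B V by (simp add: nn_integral_cmult_indicator ennreal_mult)
  also have "\<dots> \<le> (\<integral>\<^sup>+z. ennreal \<bar>u z - u x\<bar> * indicator B z + ennreal \<bar>u z - u y\<bar> * indicator B z \<partial>lborel)"
    by (intro nn_integral_mono) (auto simp: indicator_def ennreal_plus[symmetric] simp del: ennreal_plus intro!: ennreal_leI)
  also have "\<dots> = (\<integral>\<^sup>+z. ennreal \<bar>u z - u x\<bar> * indicator B z \<partial>lborel) + (\<integral>\<^sup>+z. ennreal \<bar>u z - u y\<bar> * indicator B z \<partial>lborel)"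
    using B by (intro nn_integral_add) auto
  also have "\<dots> \<le> ennreal (?I \<rho>) + ennreal (?I (2 * \<rho>))"
    by (intro add_mono 1 2)
  also have "\<dots> = ennreal (3 * \<rho> * A * V powr (1 - s) / (1 - n * s))"
    using \<rho> A0 ns by (subst ennreal_plus[symmetric]) (auto simp: field_simps add_divide_distrib[symmetric])
  finally have "\<bar>u x - u y\<bar> * V \<le> 3 * \<rho> * A * V powr (1 - s) / (1 - n * s)"
    using \<rho> A0 ns by (subst (asm) ennreal_le_iff) auto
  also have "3 * \<rho> * A * V powr (1 - s) / (1 - n * s) = 3 * \<rho> * A * V powr (- s) / (1 - n * s) * V"
    using V by (simp add: powr_diff powr_minus divide_inverse)
  finally have "\<bar>u x - u y\<bar> \<le> 3 * \<rho> * A * V powr (- s) / (1 - n * s)"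
    using V by (rule mult_right_le_imp_le)
  also have "V powr (- s) = \<omega> powr (- s) * \<rho> powr (- (n * s))"
    using \<omega> \<rho> by (simp add: V_def powr_mult powr_powr n_def flip: powr_realpow)
  also have "3 * \<rho> * A * (\<omega> powr (- s) * \<rho> powr (- (n * s))) / (1 - n * s)
      = 3 * \<omega> powr (- s) / (1 - n * s) * A * \<rho> powr (1 - n * s)"
    using \<rho> by (simp add: powr_diff powr_minus divide_inverse)
  finally show ?thesis by (simp add: \<omega>_def \<rho>_def)
qed simp

text \<open>
The Hoelder estimate bounds the supremum as well, since every point of the support is within
\<open>2 R + 1\<close> of a zero of \<open>u\<close>.
\<close>
lemma morrey_inequality:
  fixes s R :: real
  defines "n \<equiv> real DIM('a::euclidean_space)"
  assumes s: "0 < s" "s < 1 / n" and R: "R \<ge> 0"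
  obtains C where "C > 0"
    "\<And>(u :: 'a \<Rightarrow> real) G A. (\<And>x. (u has_derivative (\<lambda>h. G x \<bullet> h)) (at x)) \<Longrightarrow> continuous_on UNIV G \<Longrightarrow>
       (\<And>x. u x \<noteq> 0 \<Longrightarrow> norm x \<le> R) \<Longrightarrow> scale_le s G A \<Longrightarrow> scale_le (s - 1 / n) u (C * A)"
proof -
  have n1: "n \<ge> 1" by (simp add: n_def DIM_positive Suc_leI)
  have ns: "n * s < 1" using s n1 by (simp add: field_simps)
  define K where "K = 3 * unit_ball_vol n powr (- s) / (1 - n * s)"
  have "unit_ball_vol n > 0" by (simp add: n_def)
  then have K: "K > 0" using ns by (simp add: K_def)
  define D where "D = (2 * R + 1) powr (1 - n * s)"
  have D: "D \<ge> 1" using ns R by (simp add: D_def ge_one_powr_ge_zero)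
  show ?thesis
  proof (rule that[of "K * D"])
    fix u :: "'a \<Rightarrow> real" and G A
    assume deriv: "\<And>x. (u has_derivative (\<lambda>h. G x \<bullet> h)) (at x)" and G: "continuous_on UNIV G"
      and supp: "\<And>x. u x \<noteq> 0 \<Longrightarrow> norm x \<le> R" and le: "scale_le s G A"
    have A0: "A \<ge> 0" using le by (rule scale_le_nonneg)
    have hoelder: "\<bar>u x - u y\<bar> \<le> K * A * norm (x - y) powr (1 - n * s)" for x y
      unfolding K_def n_def using s
      by (intro morrey_hoelder_estimate[OF deriv G _ _ le]) (auto simp: n_def)
    have sup: "\<bar>u x\<bar> \<le> K * D * A" for x
    proof (cases "u x = 0")
      case False
      define b where "b = (SOME b::'a. b \<in> Basis)"
      have b: "b \<in> Basis" by (simp add: b_def SOME_Basis)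
      define y where "y = (R + 1) *\<^sub>R b"
      have ny: "norm y = R + 1" using b R by (simp add: y_def)
      then have "u y = 0" using supp[of y] by auto
      moreover have "norm (x - y) \<le> 2 * R + 1"
        using norm_triangle_ineq4[of x y] supp[OF False] ny by simp
      then have "K * A * norm (x - y) powr (1 - n * s) \<le> K * A * D"
        using K A0 ns unfolding D_def by (intro mult_left_mono powr_mono2) auto
      ultimately show ?thesis using hoelder[of x y] by (simp add: mult_ac)
    qed (use K D A0 in simp)
    have e: "- (n * (s - 1 / n)) = 1 - n * s" using n1 by (simp add: field_simps)
    have "\<bar>u x - u y\<bar> \<le> 2 * (K * D * A) * norm (x - y) powr (1 - n * s)" for x y
    proof -
      have "K * A * norm (x - y) powr (1 - n * s) \<le> (K * A * (2 * D)) * norm (x - y) powr (1 - n * s)"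
        using D K A0 mult_left_mono[of 1 "2 * D" "K * A"] by (intro mult_right_mono) auto
      with hoelder[of x y] show ?thesis by (simp add: mult_ac)
    qed
    with sup show "scale_le (s - 1 / n) u (K * D * A)"
      using s K D A0 e by (auto simp: scale_le_def simp flip: n_def)
  qed (use K D in simp)
qed

lemma scale_le_mono:
  assumes "scale_le s v K" "K \<le> L"
  shows "scale_le s v L"
proof -
  have K0: "0 \<le> K" using assms(1) by (rule scale_le_nonneg)
  show ?thesis
  proof (cases "s > 0")
    case True
    then have "ennreal (K powr (1 / s)) \<le> ennreal (L powr (1 / s))"
      using assms K0 by (intro ennreal_leI powr_mono2) auto
    with True assms K0 show ?thesis by (auto simp: scale_le_def intro: order_trans)
  next
    case False
    have "2 * K * norm (x - y) powr e \<le> 2 * L * norm (x - y) powr e" for x y :: 'a and e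
      using assms by (intro mult_right_mono) auto
    with False assms K0 show ?thesis unfolding scale_le_def by (smt (verit, ccfv_threshold))
  qed
qed

lemma scale_le_nonposI:
  fixes v :: "'a::euclidean_space \<Rightarrow> 'b::real_normed_vector"
  assumes "s \<le> 0" "0 \<le> K" "\<And>x. norm (v x) \<le> K"
    "\<And>x y. x \<noteq> y \<Longrightarrow> norm (v x - v y) \<le> 2 * K * norm (x - y) powr (- (real DIM('a) * s))"
  shows "scale_le s v K"
  unfolding scale_le_def using assms by (auto, metis cancel_comm_monoid_add_class.diff_cancel mult_zero_right norm_zero order_refl powr_0)

lemma scale_le_nonposD:
  fixes v :: "'a::euclidean_space \<Rightarrow> 'b::real_normed_vector"
  assumes "scale_le s v K" "s \<le> 0"
  shows "norm (v x) \<le> K" "norm (v x - v y) \<le> 2 * K * norm (x - y) powr (- (real DIM('a) * s))"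
  using assms by (auto simp: scale_le_def)

lemma scale_le_0I:
  fixes v :: "'a::euclidean_space \<Rightarrow> 'b::real_normed_vector"
  assumes "\<And>x. norm (v x) \<le> K"
  shows "scale_le 0 v K"
proof (rule scale_le_nonposI)
  show "0 \<le> K" using assms[of undefined] norm_ge_zero order_trans by blast
  show "norm (v x - v y) \<le> 2 * K * norm (x - y) powr (- (real DIM('a) * 0))" if "x \<noteq> y" for x y
    using that norm_triangle_ineq4[of "v x" "v y"] assms[of x] assms[of y] by simp
qed (use assms in auto)

lemma scale_le_posI:
  assumes "s > 0" "0 \<le> K" "(\<integral>\<^sup>+x. ennreal (norm (v x) powr (1 / s)) \<partial>lborel) \<le> ennreal (K powr (1 / s))"
  shows "scale_le s v K"
  using assms by (simp add: scale_le_def)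

lemma scale_le_posD:
  assumes "scale_le s v K" "s > 0"
  shows "(\<integral>\<^sup>+x. ennreal (norm (v x) powr (1 / s)) \<partial>lborel) \<le> ennreal (K powr (1 / s))"
  using assms by (simp add: scale_le_def)

section \<open>Nesting and interpolation of the scale\<close>

text \<open>
On functions supported in a fixed ball the scale is nested: the bound gets weaker as the reciprocal
exponent grows. Between Hoelder bounds this compares powers of distances below and above \<open>1\<close>,
between Lebesgue bounds it is Hoelder's inequality against the indicator of the ball.
\<close>
lemma scale_le_embedding:
  fixes t0 t R :: real
  assumes t: "t0 \<le> t" and R: "R \<ge> 0"
  obtains C where "C > 0"
    "\<And>(v :: 'a::euclidean_space \<Rightarrow> 'b::real_normed_vector) K. continuous_on UNIV v \<Longrightarrow>
       (\<And>x. v x \<noteq> 0 \<Longrightarrow> norm x \<le> R) \<Longrightarrow> scale_le t0 v K \<Longrightarrow> scale_le t v (C * K)"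
proof -
  define V where "V = unit_ball_vol (real DIM('a)) * R ^ DIM('a)"
  have V: "emeasure lborel (cball (0::'a) R) = ennreal V" "V \<ge> 0"
    using R by (auto simp: V_def emeasure_cball)
  define C where "C = 1 + V powr t + V powr (t - t0)"
  have C: "C \<ge> 1" "V powr t \<le> C" "V powr (t - t0) \<le> C" by (auto simp: C_def)
  show ?thesis
  proof (rule that[of C])
    fix v :: "'a \<Rightarrow> 'b" and K
    assume v: "continuous_on UNIV v" and supp: "\<And>x. v x \<noteq> 0 \<Longrightarrow> norm x \<le> R" and le: "scale_le t0 v K"
    have K0: "K \<ge> 0" using le by (rule scale_le_nonneg)
    have [measurable]: "(\<lambda>x. norm (v x)) \<in> borel_measurable borel"
      using v by (intro borel_measurable_continuous_onI continuous_intros)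
    have KC: "K * c \<le> C * K" if "c \<le> C" for c
      using mult_left_mono[OF that K0] by (simp add: mult.commute)
    consider "t \<le> 0" | "t0 \<le> 0" "0 < t" | "0 < t0" "t0 = t" | "0 < t0" "t0 < t" using t by linarith
    then show "scale_le t v (C * K)"
    proof cases
      case 1
      have "scale_le t v K"
      proof (rule scale_le_nonposI)
        fix x y :: 'a assume xy: "x \<noteq> y"
        define d where "d = norm (x - y)"
        have d: "d > 0" using xy by (simp add: d_def)
        have vxy: "norm (v x) \<le> K" "norm (v y) \<le> K" "norm (v x - v y) \<le> 2 * K * d powr (- (real DIM('a) * t0))"
          using scale_le_nonposD[OF le] 1 t by (auto simp: d_def)
        show "norm (v x - v y) \<le> 2 * K * norm (x - y) powr (- (real DIM('a) * t))"
        proof (cases "d \<le> 1")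
          case True
          have "real DIM('a) * t0 \<le> real DIM('a) * t" using t by (intro mult_left_mono) auto
          then have "d powr (- (real DIM('a) * t0)) \<le> d powr (- (real DIM('a) * t))"
            using d True by (intro powr_mono') auto
          then have "2 * K * d powr (- (real DIM('a) * t0)) \<le> 2 * K * d powr (- (real DIM('a) * t))"
            using K0 by (intro mult_left_mono) auto
          with vxy show ?thesis by (simp add: d_def)
        next
          case False
          have "real DIM('a) * t \<le> 0" using 1 by (simp add: mult_nonneg_nonpos)
          then have "1 \<le> d powr (- (real DIM('a) * t))" using False by (intro ge_one_powr_ge_zero) auto
          then have "2 * K * 1 \<le> 2 * K * d powr (- (real DIM('a) * t))"
            using K0 by (intro mult_left_mono) auto
          with vxy norm_triangle_ineq4[of "v x" "v y"] show ?thesis by (simp add: d_def)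
        qed
      qed (use 1 t K0 scale_le_nonposD[OF le] in auto)
      then show ?thesis using KC[of 1] C by (auto intro: scale_le_mono)
    next
      case 2
      have "scale_le t v (K * V powr t)"
      proof (rule scale_le_posI)
        have "(\<integral>\<^sup>+x. ennreal (norm (v x) powr (1 / t)) \<partial>lborel)
            \<le> (\<integral>\<^sup>+x. ennreal (K powr (1 / t)) * indicator (cball (0::'a) R) x \<partial>lborel)"
        proof (intro nn_integral_mono)
          fix x
          have "norm (v x) \<le> K" using scale_le_nonposD[OF le] 2 by auto
          then show "ennreal (norm (v x) powr (1 / t)) \<le> ennreal (K powr (1 / t)) * indicator (cball (0::'a) R) x"
            using supp[of x] 2 by (cases "v x = 0") (auto intro!: ennreal_leI powr_mono2)
        qed
        also have "\<dots> = ennreal (K powr (1 / t) * V)"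
          using V by (simp add: nn_integral_cmult_indicator ennreal_mult)
        also have "K powr (1 / t) * V = (K * V powr t) powr (1 / t)"
          using K0 V 2 by (simp add: powr_mult powr_powr)
        finally show "(\<integral>\<^sup>+x. ennreal (norm (v x) powr (1 / t)) \<partial>lborel) \<le> ennreal ((K * V powr t) powr (1 / t))" .
      qed (use 2 K0 in auto)
      then show ?thesis using KC C by (auto intro: scale_le_mono)
    next
      case 3
      then show ?thesis using le KC[of 1] C by (auto intro: scale_le_mono)
    next
      case 4
      have "scale_le t v (K * V powr (t - t0))"
      proof (rule scale_le_posI)
        have "(\<integral>\<^sup>+x. ennreal (norm (v x) powr (1 / t)) \<partial>lborel)
          = (\<integral>\<^sup>+x. ennreal ((norm (v x) powr (1 / t0)) powr (t0 / t) * indicat_real (cball 0 R) x powr (1 - t0 / t)) \<partial>lborel)"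
        proof (intro nn_integral_cong)
          fix x
          show "ennreal (norm (v x) powr (1 / t))
            = ennreal ((norm (v x) powr (1 / t0)) powr (t0 / t) * indicat_real (cball 0 R) x powr (1 - t0 / t))"
            using supp[of x] 4 by (cases "v x = 0") (auto simp: powr_powr)
        qed
        also have "\<dots> \<le> ennreal ((K powr (1 / t0)) powr (t0 / t) * V powr (1 - t0 / t))"
          using 4 V scale_le_posD[OF le]
          by (intro nn_integral_powr_mult_le borel_measurable_indicator) (auto simp: ennreal_indicator)
        also have "(K powr (1 / t0)) powr (t0 / t) * V powr (1 - t0 / t) = (K * V powr (t - t0)) powr (1 / t)"
          using K0 V 4 by (simp add: powr_mult powr_powr diff_divide_distrib)
        finally show "(\<integral>\<^sup>+x. ennreal (norm (v x) powr (1 / t)) \<partial>lborel)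
            \<le> ennreal ((K * V powr (t - t0)) powr (1 / t))" .
      qed (use 4 K0 in auto)
      then show ?thesis using KC C by (auto intro: scale_le_mono)
    qed
  qed (use C in simp)
qed

lemma scale_le_interpolate_pos:
  fixes v :: "'a::euclidean_space \<Rightarrow> 'b::real_normed_vector"
  assumes v: "continuous_on UNIV v" and \<theta>: "0 < \<theta>" "\<theta> < 1" and "t > 0" "r > 0"
    and A: "scale_le t v A" and B: "scale_le r v B"
  shows "scale_le (\<theta> * t + (1 - \<theta>) * r) v (A powr \<theta> * B powr (1 - \<theta>))"
proof (rule scale_le_posI)
  define q where "q = \<theta> * t + (1 - \<theta>) * r"
  have q: "q > 0" using assms by (simp add: q_def add_pos_pos)
  have [measurable]: "(\<lambda>x. norm (v x)) \<in> borel_measurable borel"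
    using v by (intro borel_measurable_continuous_onI continuous_intros)
  have A0: "A \<ge> 0" and B0: "B \<ge> 0" using A B by (auto dest: scale_le_nonneg)
  define \<alpha> where "\<alpha> = \<theta> * t / q"
  have q0: "q > (1 - \<theta>) * r" using assms by (simp add: q_def)
  have \<alpha>': "1 - \<alpha> = (1 - \<theta>) * r / q" using q by (simp add: \<alpha>_def q_def field_simps)
  have \<alpha>: "0 < \<alpha>" "\<alpha> < 1"
    using assms q \<alpha>' by (simp add: \<alpha>_def, smt (verit, ccfv_SIG) divide_pos_pos mult_pos_pos)
  have ea: "1 / t * \<alpha> = \<theta> / q" "1 / r * (1 - \<alpha>) = (1 - \<theta>) / q"
    using assms by (auto simp: \<alpha>' , simp add: \<alpha>_def)
  have sum: "\<theta> / q + (1 - \<theta>) / q = 1 / q" by (simp add: add_divide_distrib[symmetric])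
  have "(\<integral>\<^sup>+x. ennreal (norm (v x) powr (1 / q)) \<partial>lborel)
     = (\<integral>\<^sup>+x. ennreal ((norm (v x) powr (1 / t)) powr \<alpha> * (norm (v x) powr (1 / r)) powr (1 - \<alpha>)) \<partial>lborel)"
    unfolding powr_powr ea powr_add[symmetric] sum ..
  also have "\<dots> \<le> ennreal ((A powr (1 / t)) powr \<alpha> * (B powr (1 / r)) powr (1 - \<alpha>))"
    using \<alpha> scale_le_posD[OF A] scale_le_posD[OF B] assms by (intro nn_integral_powr_mult_le) auto
  also have "(A powr (1 / t)) powr \<alpha> * (B powr (1 / r)) powr (1 - \<alpha>) = (A powr \<theta> * B powr (1 - \<theta>)) powr (1 / q)"
    unfolding powr_powr ea using A0 B0 by (simp add: powr_mult powr_powr)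
  finally show "(\<integral>\<^sup>+x. ennreal (norm (v x) powr (1 / (\<theta> * t + (1 - \<theta>) * r))) \<partial>lborel)
     \<le> ennreal ((A powr \<theta> * B powr (1 - \<theta>)) powr (1 / (\<theta> * t + (1 - \<theta>) * r)))"
    by (simp add: q_def)
qed (use assms in \<open>auto intro: add_pos_pos\<close>)

text \<open>
A quantity with two upper bounds is bounded by their geometric means; applied to values and to
increments, this is interpolation between Hoelder spaces.
\<close>
lemma le_powr_interpolate:
  fixes m :: real
  assumes "0 \<le> m" "m \<le> X" "m \<le> Y" "0 \<le> \<theta>" "\<theta> \<le> 1"
  shows "m \<le> X powr \<theta> * Y powr (1 - \<theta>)"
proof -
  have "m = m powr \<theta> * m powr (1 - \<theta>)" using assms by (simp flip: powr_add)
  also have "\<dots> \<le> X powr \<theta> * Y powr (1 - \<theta>)"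
    using assms by (intro mult_mono powr_mono2) auto
  finally show ?thesis .
qed

lemma scale_le_interpolate_nonpos:
  fixes v :: "'a::euclidean_space \<Rightarrow> 'b::real_normed_vector"
  assumes \<theta>: "0 < \<theta>" "\<theta> < 1" and "t \<le> 0" "r \<le> 0"
    and A: "scale_le t v A" and B: "scale_le r v B"
  shows "scale_le (\<theta> * t + (1 - \<theta>) * r) v (A powr \<theta> * B powr (1 - \<theta>))"
proof (rule scale_le_nonposI)
  have A0: "A \<ge> 0" and B0: "B \<ge> 0" using A B by (auto dest: scale_le_nonneg)
  show "\<theta> * t + (1 - \<theta>) * r \<le> 0" using assms by (simp add: add_nonpos_nonpos mult_nonneg_nonpos)
  show "norm (v x) \<le> A powr \<theta> * B powr (1 - \<theta>)" for x
    using assms scale_le_nonposD(1)[OF A] scale_le_nonposD(1)[OF B] by (intro le_powr_interpolate) auto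
  fix x y :: 'a
  let ?d = "norm (x - y)" and ?n = "real DIM('a)"
  have "norm (v x - v y) \<le> (2 * A * ?d powr (- (?n * t))) powr \<theta> * (2 * B * ?d powr (- (?n * r))) powr (1 - \<theta>)"
    using assms scale_le_nonposD(2)[OF A] scale_le_nonposD(2)[OF B] by (intro le_powr_interpolate) auto
  also have "\<dots> = (2 powr \<theta> * 2 powr (1 - \<theta>)) * (A powr \<theta> * B powr (1 - \<theta>)) *
      (?d powr (- (?n * t) * \<theta>) * ?d powr (- (?n * r) * (1 - \<theta>)))"
    using A0 B0 by (simp add: powr_mult powr_powr)
  also have "2 powr \<theta> * 2 powr (1 - \<theta>) = (2::real)" by (simp flip: powr_add)
  also have "?d powr (- (?n * t) * \<theta>) * ?d powr (- (?n * r) * (1 - \<theta>)) = ?d powr (- (?n * (\<theta> * t + (1 - \<theta>) * r)))"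
    unfolding powr_add[symmetric] by (simp add: algebra_simps)
  finally show "norm (v x - v y) \<le> 2 * (A powr \<theta> * B powr (1 - \<theta>)) *
      ?d powr (- (?n * (\<theta> * t + (1 - \<theta>) * r)))" .
qed auto

lemma scale_le_interpolate_sup:
  fixes v :: "'a::euclidean_space \<Rightarrow> 'b::real_normed_vector"
  assumes v: "continuous_on UNIV v" and \<theta>: "0 < \<theta>" "\<theta> < 1" and "r > 0"
    and A: "\<And>x. norm (v x) \<le> A" and B: "scale_le r v B"
  shows "scale_le ((1 - \<theta>) * r) v (A powr \<theta> * B powr (1 - \<theta>))"
proof (rule scale_le_posI)
  define q where "q = (1 - \<theta>) * r"
  have q: "q > 0" using assms by (simp add: q_def)
  have [measurable]: "(\<lambda>x. norm (v x)) \<in> borel_measurable borel"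
    using v by (intro borel_measurable_continuous_onI continuous_intros)
  have B0: "B \<ge> 0" using B by (auto dest: scale_le_nonneg)
  have A0: "A \<ge> 0" using A[of undefined] norm_ge_zero order_trans by blast
  have r: "1 / r = (1 - \<theta>) / q" using assms by (simp add: q_def)
  have sum: "1 / q = \<theta> / q + 1 / r" unfolding r by (simp add: add_divide_distrib[symmetric])
  have "(\<integral>\<^sup>+x. ennreal (norm (v x) powr (1 / q)) \<partial>lborel)
     \<le> (\<integral>\<^sup>+x. ennreal (A powr (\<theta> / q)) * ennreal (norm (v x) powr (1 / r)) \<partial>lborel)"
  proof (intro nn_integral_mono)
    fix x
    have "norm (v x) powr (1 / q) = norm (v x) powr (\<theta> / q) * norm (v x) powr (1 / r)"
      unfolding sum by (rule powr_add)
    also have "\<dots> \<le> A powr (\<theta> / q) * norm (v x) powr (1 / r)"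
      using \<theta> q A by (intro mult_right_mono powr_mono2) auto
    finally show "ennreal (norm (v x) powr (1 / q)) \<le> ennreal (A powr (\<theta> / q)) * ennreal (norm (v x) powr (1 / r))"
      by (simp add: ennreal_mult[symmetric] ennreal_leI)
  qed
  also have "\<dots> = ennreal (A powr (\<theta> / q)) * (\<integral>\<^sup>+x. ennreal (norm (v x) powr (1 / r)) \<partial>lborel)"
    by (intro nn_integral_cmult) auto
  also have "\<dots> \<le> ennreal (A powr (\<theta> / q)) * ennreal (B powr (1 / r))"
    using scale_le_posD[OF B] assms by (intro mult_left_mono) auto
  also have "\<dots> = ennreal ((A powr \<theta> * B powr (1 - \<theta>)) powr (1 / q))"
    unfolding r using A0 B0 by (simp add: powr_mult powr_powr ennreal_mult)
  finally show "(\<integral>\<^sup>+x. ennreal (norm (v x) powr (1 / ((1 - \<theta>) * r))) \<partial>lborel)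
     \<le> ennreal ((A powr \<theta> * B powr (1 - \<theta>)) powr (1 / ((1 - \<theta>) * r)))"
    by (simp add: q_def)
qed (use assms in auto)

text \<open>
A Hoelder bound keeps \<open>v\<close> above half of its value \<open>M\<close> at \<open>x\<close> on a ball whose radius is a power of
\<open>M / A\<close>, so the Lebesgue bound \<open>B\<close> limits \<open>M\<close>. The exponent \<open>\<sigma>\<close> is the one with
\<open>\<sigma> * t + (1 - \<sigma>) * r = 0\<close>: this is interpolation at the parameter where the scale passes
through \<open>L\<^sup>\<infinity>\<close>.
\<close>
lemma sup_le_hoelder_Lp:
  fixes t r :: real
  defines "\<sigma> \<equiv> r / (r - t)"
  assumes tr: "t < 0" "0 < r"
  obtains C where "C > 0"
    "\<And>(v :: 'a::euclidean_space \<Rightarrow> 'b::real_normed_vector) A B x. scale_le t v A \<Longrightarrow> scale_le r v B \<Longrightarrow>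
       norm (v x) \<le> C * (A powr \<sigma> * B powr (1 - \<sigma>))"
proof -
  define n where "n = real DIM('a)"
  have n1: "n \<ge> 1" by (simp add: n_def DIM_positive Suc_leI)
  define h where "h = - (n * t)"
  have h: "h > 0" using tr n1 by (simp add: h_def mult_pos_neg)
  define \<kappa> where "\<kappa> = - r / t"
  have \<kappa>: "\<kappa> > 0" using tr by (simp add: \<kappa>_def divide_pos_neg)
  have \<kappa>': "n * (1 / h) * r = \<kappa>" using tr n1 by (simp add: \<kappa>_def h_def)
  have \<sigma>: "(1 + \<kappa>) * (1 - \<sigma>) = 1" "\<kappa> * (1 - \<sigma>) = \<sigma>" "0 < 1 - \<sigma>"
    using tr by (auto simp: \<kappa>_def \<sigma>_def field_simps)
  define \<omega> where "\<omega> = unit_ball_vol n"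
  have \<omega>: "\<omega> > 0" by (simp add: \<omega>_def n_def)
  define C where "C = (2 * \<omega> powr (- r) * 4 powr \<kappa>) powr (1 - \<sigma>)"
  show ?thesis
  proof (rule that[of C])
    show "C > 0" using \<omega> by (simp add: C_def)
    fix v :: "'a \<Rightarrow> 'b" and A B x
    assume A: "scale_le t v A" and B: "scale_le r v B"
    have A0: "A \<ge> 0" and B0: "B \<ge> 0" using A B by (auto dest: scale_le_nonneg)
    define M where "M = norm (v x)"
    show "norm (v x) \<le> C * (A powr \<sigma> * B powr (1 - \<sigma>))"
    proof (cases "M = 0")
      case True
      then show ?thesis by (simp add: M_def C_def)
    next
      case False
      then have M: "M > 0" by (simp add: M_def)
      have "M \<le> A" using scale_le_nonposD(1)[OF A] tr by (simp add: M_def)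
      then have A1: "A > 0" using M by simp
      \<comment> \<open>The radius on which an increment of at most \<open>2 * A * \<rho> powr h\<close> costs half of \<open>M\<close>.\<close>
      define \<rho> where "\<rho> = (M / (4 * A)) powr (1 / h)"
      have \<rho>: "\<rho> > 0" using M A1 by (simp add: \<rho>_def)
      have \<rho>h: "\<rho> powr h = M / (4 * A)" using M A1 h by (simp add: \<rho>_def powr_powr)
      have low: "M / 2 \<le> norm (v y)" if "y \<in> cball x \<rho>" for y
      proof -
        have "norm (v x - v y) \<le> 2 * A * norm (x - y) powr h"
          using scale_le_nonposD(2)[OF A] tr by (simp add: h_def n_def)
        also have "\<dots> \<le> 2 * A * \<rho> powr h"
          using that A0 h by (intro mult_left_mono powr_mono2) (auto simp: dist_norm)
        also have "\<dots> = M / 2" using A1 by (simp add: \<rho>h)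
        finally show ?thesis using norm_triangle_ineq2[of "v x" "v y"] by (simp add: M_def)
      qed
      have "ennreal ((M / 2) powr (1 / r) * (\<omega> * \<rho> powr n)) = ennreal ((M / 2) powr (1 / r)) * emeasure lborel (cball x \<rho>)"
        using \<rho> \<omega> by (simp add: emeasure_cball ennreal_mult \<omega>_def n_def powr_realpow)
      also have "\<dots> = (\<integral>\<^sup>+y. ennreal ((M / 2) powr (1 / r)) * indicator (cball x \<rho>) y \<partial>lborel)"
        by (simp add: nn_integral_cmult_indicator)
      also have "\<dots> \<le> (\<integral>\<^sup>+y. ennreal (norm (v y) powr (1 / r)) \<partial>lborel)"
        using low M tr by (intro nn_integral_mono) (auto simp: indicator_def intro!: ennreal_leI powr_mono2)
      also have "\<dots> \<le> ennreal (B powr (1 / r))"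
        using scale_le_posD[OF B] tr by simp
      finally have "(M / 2) powr (1 / r) * (\<omega> * \<rho> powr n) \<le> B powr (1 / r)"
        by (simp add: ennreal_le_iff)
      then have "((M / 2) powr (1 / r) * (\<omega> * \<rho> powr n)) powr r \<le> (B powr (1 / r)) powr r"
        using \<omega> tr by (intro powr_mono2) auto
      moreover have "((M / 2) powr (1 / r) * (\<omega> * \<rho> powr n)) powr r = M / 2 * (\<omega> powr r * (M / (4 * A)) powr \<kappa>)"
        using M \<omega> tr A1 \<kappa>' by (simp add: powr_mult powr_powr \<rho>_def mult_ac)
      ultimately have "M / 2 * (\<omega> powr r * (M / (4 * A)) powr \<kappa>) \<le> B"
        using B0 tr by (simp add: powr_powr)
      then have "M powr (1 + \<kappa>) \<le> (2 * \<omega> powr (- r) * 4 powr \<kappa>) * (A powr \<kappa> * B)"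
        using M A1 \<omega> by (simp add: powr_add powr_divide powr_mult powr_minus field_simps)
      then have "(M powr (1 + \<kappa>)) powr (1 - \<sigma>) \<le> ((2 * \<omega> powr (- r) * 4 powr \<kappa>) * (A powr \<kappa> * B)) powr (1 - \<sigma>)"
        using \<sigma> by (intro powr_mono2) auto
      also have "\<dots> = C * (A powr \<sigma> * B powr (1 - \<sigma>))"
        using A0 B0 \<sigma>(2) by (simp add: C_def powr_mult powr_powr)
      also have "(M powr (1 + \<kappa>)) powr (1 - \<sigma>) = M"
        unfolding powr_powr \<sigma>(1) using M by simp
      finally show ?thesis by (simp add: M_def)
    qed
  qed
qed

text \<open>
Between a Hoelder and a Lebesgue bound one first interpolates to \<open>L\<^sup>\<infinity>\<close>, at the parameter \<open>\<sigma>\<close>, and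
then between \<open>L\<^sup>\<infinity>\<close> and whichever end lies on the side of the target.
\<close>
lemma scale_le_interpolate_mixed:
  fixes t r \<theta> :: real
  assumes \<theta>: "0 < \<theta>" "\<theta> < 1" and tr: "t < 0" "0 < r"
  obtains C where "C > 0"
    "\<And>(v :: 'a::euclidean_space \<Rightarrow> 'b::real_normed_vector) A B. continuous_on UNIV v \<Longrightarrow>
       scale_le t v A \<Longrightarrow> scale_le r v B \<Longrightarrow>
       scale_le (\<theta> * t + (1 - \<theta>) * r) v (C * (A powr \<theta> * B powr (1 - \<theta>)))"
proof -
  define \<sigma> where "\<sigma> = r / (r - t)"
  have \<sigma>: "0 < \<sigma>" "\<sigma> < 1" using tr by (auto simp: \<sigma>_def field_simps)
  obtain C where C: "C > 0"
    "\<And>(v :: 'a \<Rightarrow> 'b) A B x. scale_le t v A \<Longrightarrow> scale_le r v B \<Longrightarrow>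
       norm (v x) \<le> C * (A powr \<sigma> * B powr (1 - \<sigma>))"
    using sup_le_hoelder_Lp[OF tr, where 'a = 'a and 'b = 'b] unfolding \<sigma>_def by blast
  consider "\<theta> < \<sigma>" | "\<theta> = \<sigma>" | "\<theta> > \<sigma>" by linarith
  then show ?thesis
  proof cases
    case 1
    \<comment> \<open>Position of the target between \<open>r\<close> and \<open>0\<close>.\<close>
    define \<eta> where "\<eta> = \<theta> / \<sigma>"
    have \<eta>: "0 < \<eta>" "\<eta> < 1" using 1 \<theta> \<sigma> by (auto simp: \<eta>_def)
    have e: "(1 - \<eta>) * r = \<theta> * t + (1 - \<theta>) * r" "\<sigma> * \<eta> = \<theta>" "(1 - \<sigma>) * \<eta> + (1 - \<eta>) = 1 - \<theta>"
      using tr by (auto simp: \<eta>_def \<sigma>_def field_simps)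
    show ?thesis
    proof (rule that[of "C powr \<eta>"])
      fix v :: "'a \<Rightarrow> 'b" and A B
      assume v: "continuous_on UNIV v" and A: "scale_le t v A" and B: "scale_le r v B"
      have A0: "A \<ge> 0" and B0: "B \<ge> 0" using A B by (auto dest: scale_le_nonneg)
      have "scale_le ((1 - \<eta>) * r) v ((C * (A powr \<sigma> * B powr (1 - \<sigma>))) powr \<eta> * B powr (1 - \<eta>))"
        by (rule scale_le_interpolate_sup[OF v \<eta> tr(2) C(2)[OF A B] B])
      moreover have "(C * (A powr \<sigma> * B powr (1 - \<sigma>))) powr \<eta> * B powr (1 - \<eta>)
          = C powr \<eta> * (A powr (\<sigma> * \<eta>) * B powr ((1 - \<sigma>) * \<eta> + (1 - \<eta>)))"
        using C A0 B0 by (simp add: powr_mult powr_powr powr_add)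
      ultimately show "scale_le (\<theta> * t + (1 - \<theta>) * r) v (C powr \<eta> * (A powr \<theta> * B powr (1 - \<theta>)))"
        unfolding e by simp
    qed (use C in simp)
  next
    case 2
    have e: "\<theta> * t + (1 - \<theta>) * r = 0" using tr by (simp add: 2 \<sigma>_def field_simps)
    show ?thesis
      using C unfolding 2[symmetric] by (intro that[of C]) (auto simp: e intro!: scale_le_0I)
  next
    case 3
    \<comment> \<open>Position of the target between \<open>0\<close> and \<open>t\<close>.\<close>
    define \<tau> where "\<tau> = (\<theta> * t + (1 - \<theta>) * r) / t"
    have \<tau>1: "1 - \<tau> = (1 - \<theta>) / (1 - \<sigma>)" using tr by (simp add: \<tau>_def \<sigma>_def field_simps)
    have \<tau>: "0 < \<tau>" "\<tau> < 1"
      using 3 \<theta> \<sigma> \<tau>1 by (smt (verit) divide_less_eq_1, smt (verit) divide_pos_pos)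
    have e: "\<tau> * t + (1 - \<tau>) * 0 = \<theta> * t + (1 - \<theta>) * r" using tr by (simp add: \<tau>_def)
    have e2: "(1 - \<sigma>) * (1 - \<tau>) = 1 - \<theta>" using \<sigma> by (simp add: \<tau>1)
    have e3: "\<tau> + \<sigma> * (1 - \<tau>) = \<theta>" using e2 by (simp add: algebra_simps)
    show ?thesis
    proof (rule that[of "C powr (1 - \<tau>)"])
      fix v :: "'a \<Rightarrow> 'b" and A B
      assume v: "continuous_on UNIV v" and A: "scale_le t v A" and B: "scale_le r v B"
      have A0: "A \<ge> 0" and B0: "B \<ge> 0" using A B by (auto dest: scale_le_nonneg)
      have "scale_le (\<tau> * t + (1 - \<tau>) * 0) v (A powr \<tau> * (C * (A powr \<sigma> * B powr (1 - \<sigma>))) powr (1 - \<tau>))"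
        using \<tau> tr A by (intro scale_le_interpolate_nonpos scale_le_0I C(2)[OF A B]) auto
      moreover have "A powr \<tau> * (C * (A powr \<sigma> * B powr (1 - \<sigma>))) powr (1 - \<tau>)
          = C powr (1 - \<tau>) * (A powr (\<tau> + \<sigma> * (1 - \<tau>)) * B powr ((1 - \<sigma>) * (1 - \<tau>)))"
        using C A0 B0 by (simp add: powr_mult powr_powr powr_add)
      ultimately show "scale_le (\<theta> * t + (1 - \<theta>) * r) v (C powr (1 - \<tau>) * (A powr \<theta> * B powr (1 - \<theta>)))"
        unfolding e e2 e3 by simp
    qed (use C in simp)
  qed
qed

text \<open>
Positivity of the bounds serves the end points \<open>\<theta> = 0\<close> and \<open>\<theta> = 1\<close>: it makes the factor with
exponent \<open>0\<close> equal to \<open>1\<close>, whereas \<open>0 powr 0 = 0\<close>.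
\<close>
lemma scale_le_interpolate:
  fixes t r \<theta> :: real
  assumes \<theta>: "0 \<le> \<theta>" "\<theta> \<le> 1"
  obtains C where "C > 0"
    "\<And>(v :: 'a::euclidean_space \<Rightarrow> 'b::real_normed_vector) A B. continuous_on UNIV v \<Longrightarrow>
       scale_le t v A \<Longrightarrow> scale_le r v B \<Longrightarrow> A > 0 \<Longrightarrow> B > 0 \<Longrightarrow>
       scale_le (\<theta> * t + (1 - \<theta>) * r) v (C * (A powr \<theta> * B powr (1 - \<theta>)))"
proof -
  consider "\<theta> = 0" | "\<theta> = 1" | (pos) "0 < \<theta>" "\<theta> < 1" "t > 0" "r > 0"
    | (neg) "0 < \<theta>" "\<theta> < 1" "t \<le> 0" "r \<le> 0"
    | (z1) "0 < \<theta>" "\<theta> < 1" "t = 0" "r > 0" | (z2) "0 < \<theta>" "\<theta> < 1" "t > 0" "r = 0"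
    | (m1) "0 < \<theta>" "\<theta> < 1" "t < 0" "r > 0" | (m2) "0 < \<theta>" "\<theta> < 1" "t > 0" "r < 0"
    using \<theta> by linarith
  then show ?thesis
  proof cases
    case pos
    then show ?thesis using scale_le_interpolate_pos by (intro that[of 1]) auto
  next
    case neg
    then show ?thesis using scale_le_interpolate_nonpos by (intro that[of 1]) auto
  next
    case z1
    show ?thesis
    proof (rule that[of 1])
      fix v :: "'a \<Rightarrow> 'b" and A B
      assume v: "continuous_on UNIV v" and A: "scale_le t v A" and B: "scale_le r v B"
      have "norm (v x) \<le> A" for x using scale_le_nonposD(1)[OF A] z1 by simp
      from scale_le_interpolate_sup[OF v z1(1,2,4) this B] z1
      show "scale_le (\<theta> * t + (1 - \<theta>) * r) v (1 * (A powr \<theta> * B powr (1 - \<theta>)))" by simp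
    qed simp
  next
    case z2
    show ?thesis
    proof (rule that[of 1])
      fix v :: "'a \<Rightarrow> 'b" and A B
      assume v: "continuous_on UNIV v" and A: "scale_le t v A" and B: "scale_le r v B"
      have "norm (v x) \<le> B" for x using scale_le_nonposD(1)[OF B] z2 by simp
      from scale_le_interpolate_sup[OF v _ _ z2(3) this A, of "1 - \<theta>"] z2
      show "scale_le (\<theta> * t + (1 - \<theta>) * r) v (1 * (A powr \<theta> * B powr (1 - \<theta>)))"
        by (simp add: mult.commute)
    qed simp
  next
    case m1
    obtain C where "C > 0"
      "\<And>(v :: 'a \<Rightarrow> 'b) A B. continuous_on UNIV v \<Longrightarrow> scale_le t v A \<Longrightarrow> scale_le r v B \<Longrightarrow>
       scale_le (\<theta> * t + (1 - \<theta>) * r) v (C * (A powr \<theta> * B powr (1 - \<theta>)))"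
      using scale_le_interpolate_mixed[OF m1, where 'a = 'a and 'b = 'b] by blast
    then show ?thesis by (intro that[of C]) auto
  next
    case m2
    then have "0 < 1 - \<theta>" "1 - \<theta> < 1" by auto
    from scale_le_interpolate_mixed[OF this m2(4) m2(3), where 'a = 'a and 'b = 'b]
    obtain C where C: "C > 0"
      "\<And>(v :: 'a \<Rightarrow> 'b) A B. continuous_on UNIV v \<Longrightarrow> scale_le r v A \<Longrightarrow> scale_le t v B \<Longrightarrow>
       scale_le ((1 - \<theta>) * r + \<theta> * t) v (C * (A powr (1 - \<theta>) * B powr \<theta>))"
      by auto
    show ?thesis
    proof (rule that[of C])
      fix v :: "'a \<Rightarrow> 'b" and A B
      assume v: "continuous_on UNIV v" and A: "scale_le t v A" and B: "scale_le r v B"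
      from C(2)[OF v B A]
      show "scale_le (\<theta> * t + (1 - \<theta>) * r) v (C * (A powr \<theta> * B powr (1 - \<theta>)))"
        by (simp add: add.commute mult.commute)
    qed (rule C)
  qed (auto intro!: that[of 1])
qed

section \<open>Power weights\<close>

text \<open>
On the annulus \<open>\<delta> \<le> norm x \<le> R\<close> the function \<open>norm x powr e\<close> is bounded and Lipschitz, hence a
multiplier for every Hoelder exponent below \<open>1\<close>. The increment of a product is split by the Leibniz
rule when both points lie in the support; when one of them does not, the value of \<open>v\<close> at the other
is itself an increment of \<open>v\<close>.
\<close>
lemma scale_le_weighted:
  fixes s e \<delta> R :: real
  assumes s: "- 1 / real CARD('n::finite) < s" and \<delta>: "0 < \<delta>" "\<delta> \<le> R"
  obtains C where "C > 0"
    "\<And>(v :: real ^ 'n \<Rightarrow> 'b::real_normed_vector) K. continuous_on UNIV v \<Longrightarrow>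
       (\<And>x. v x \<noteq> 0 \<Longrightarrow> \<delta> \<le> norm x \<and> norm x \<le> R) \<Longrightarrow>
       scale_le s v K \<Longrightarrow> scale_le s (weighted e v) (C * K)"
proof -
  define M where "M = \<delta> powr e + R powr e"
  define L where "L = \<bar>e\<bar> * (\<delta> powr (e - 1) + R powr (e - 1))"
  have bound: "a powr f \<le> \<delta> powr f + R powr f" if "\<delta> \<le> a" "a \<le> R" for a f
  proof (cases "f \<ge> 0")
    case True
    then have "a powr f \<le> R powr f" using that \<delta> by (intro powr_mono2) auto
    then show ?thesis by (simp add: add_increasing)
  next
    case False
    then have "a powr f \<le> \<delta> powr f" using that \<delta> by (intro powr_mono2') auto
    then show ?thesis by (simp add: add_increasing2)
  qed
  have M: "M > 0" using \<delta> by (simp add: M_def add_pos_nonneg)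
  have L: "L \<ge> 0" by (simp add: L_def)
  have lip: "\<bar>a powr e - b powr e\<bar> \<le> L * \<bar>a - b\<bar>" if "\<delta> \<le> a" "a \<le> R" "\<delta> \<le> b" "b \<le> R" for a b
  proof -
    have "norm (a powr e - b powr e) \<le> L * norm (a - b)"
    proof (rule field_differentiable_bound[of "{\<delta>..R}" "\<lambda>x. x powr e" "\<lambda>x. e * x powr (e - 1)"])
      fix x assume x: "x \<in> {\<delta>..R}"
      show "((\<lambda>x. x powr e) has_field_derivative e * x powr (e - 1)) (at x within {\<delta>..R})"
        using x \<delta> by (auto intro!: derivative_eq_intros)
      show "norm (e * x powr (e - 1)) \<le> L"
        using bound[of x "e - 1"] x by (auto simp: L_def abs_mult intro!: mult_left_mono)
    qed (use that in auto)
    then show ?thesis by simp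
  qed
  define C where "C = M + L * (2 * R + 1)"
  have C: "C \<ge> M" using L \<delta> by (simp add: C_def)
  show ?thesis
  proof (rule that[of C])
    fix v :: "real ^ 'n \<Rightarrow> 'b" and K
    assume v: "continuous_on UNIV v"
      and supp: "\<And>x. v x \<noteq> 0 \<Longrightarrow> \<delta> \<le> norm x \<and> norm x \<le> R" and le: "scale_le s v K"
    have K0: "K \<ge> 0" using le by (rule scale_le_nonneg)
    have [measurable]: "(\<lambda>x. norm (v x)) \<in> borel_measurable borel"
      using v by (intro borel_measurable_continuous_onI continuous_intros)
    have pt: "norm (weighted e v x) \<le> M * norm (v x)" for x
      using supp[of x] bound[of "norm x" e]
      by (cases "v x = 0") (auto simp: weighted_def M_def intro!: mult_right_mono)
    show "scale_le s (weighted e v) (C * K)"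
    proof (cases "s > 0")
      case True
      have "(\<integral>\<^sup>+x. ennreal (norm (weighted e v x) powr (1 / s)) \<partial>lborel)
          \<le> (\<integral>\<^sup>+x. ennreal (M powr (1 / s)) * ennreal (norm (v x) powr (1 / s)) \<partial>lborel)"
      proof (intro nn_integral_mono)
        fix x
        have "norm (weighted e v x) powr (1 / s) \<le> (M * norm (v x)) powr (1 / s)"
          using pt True by (intro powr_mono2) auto
        then show "ennreal (norm (weighted e v x) powr (1 / s))
            \<le> ennreal (M powr (1 / s)) * ennreal (norm (v x) powr (1 / s))"
          using M by (simp add: ennreal_mult[symmetric] powr_mult ennreal_leI)
      qed
      also have "\<dots> = ennreal (M powr (1 / s)) * (\<integral>\<^sup>+x. ennreal (norm (v x) powr (1 / s)) \<partial>lborel)"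
        by (intro nn_integral_cmult) measurable
      also have "\<dots> \<le> ennreal (M powr (1 / s)) * ennreal (K powr (1 / s))"
        using scale_le_posD[OF le True] by (intro mult_left_mono) auto
      also have "\<dots> = ennreal ((M * K) powr (1 / s))"
        using M K0 by (simp add: powr_mult ennreal_mult)
      finally have "scale_le s (weighted e v) (M * K)" using True M K0 by (intro scale_le_posI) auto
      then show ?thesis using C K0 by (auto elim!: scale_le_mono intro: mult_right_mono)
    next
      case False
      define h where "h = - (real CARD('n) * s)"
      have "real CARD('n) * s \<le> 0" using False by (simp add: mult_nonneg_nonpos)
      then have h: "0 \<le> h" "h < 1" using s by (auto simp: h_def field_simps)
      have vb: "norm (v x) \<le> K" and vh: "norm (v x - v y) \<le> 2 * K * norm (x - y) powr h" for x y
        using scale_le_nonposD[OF le] False by (auto simp: h_def)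
      have Mh: "M * (2 * K * d powr h) \<le> 2 * (C * K) * d powr h" for d
        using C K0 mult_right_mono[OF C, of "2 * K * d powr h"] by (simp add: mult_ac)
      show ?thesis
      proof (rule scale_le_nonposI)
        show "norm (weighted e v x) \<le> C * K" for x
        proof -
          have "M * norm (v x) \<le> C * K" using C M vb by (intro mult_mono) auto
          with pt[of x] show ?thesis by simp
        qed
        fix x y :: "real ^ 'n"
        define d where "d = norm (x - y)"
        have ineq: "norm (weighted e v x - weighted e v y) \<le> 2 * (C * K) * d powr h"
        proof -
          consider "v x = 0" | "v y = 0" | "v x \<noteq> 0" "v y \<noteq> 0" by blast
          then show ?thesis
          proof cases
            case 1
            have "norm (weighted e v x - weighted e v y) = norm (weighted e v y)" using 1 by (simp add: weighted_def)
            also have "\<dots> \<le> M * norm (v x - v y)" using pt[of y] 1 by simp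
            also have "\<dots> \<le> M * (2 * K * d powr h)" using M vh by (intro mult_left_mono) (auto simp: d_def)
            finally show ?thesis using Mh[of d] by simp
          next
            case 2
            have "norm (weighted e v x - weighted e v y) = norm (weighted e v x)" using 2 by (simp add: weighted_def)
            also have "\<dots> \<le> M * norm (v x - v y)" using pt[of x] 2 by simp
            also have "\<dots> \<le> M * (2 * K * d powr h)" using M vh by (intro mult_left_mono) (auto simp: d_def)
            finally show ?thesis using Mh[of d] by simp
          next
            case 3
            note sx = supp[OF 3(1)] and sy = supp[OF 3(2)]
            have d0: "0 \<le> d" "d \<le> 2 * R + 1"
              using norm_triangle_ineq4[of x y] sx sy by (auto simp: d_def)
            have "d = d powr h * d powr (1 - h)" using d0 by (simp flip: powr_add)
            also have "\<dots> \<le> d powr h * (2 * R + 1) powr (1 - h)"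
              using d0 h by (intro mult_left_mono powr_mono2) auto
            also have "\<dots> \<le> d powr h * (2 * R + 1)"
              using h \<delta> powr_mono[of "1 - h" 1 "2 * R + 1"] by (intro mult_left_mono) auto
            finally have dd: "d \<le> d powr h * (2 * R + 1)" .
            have "weighted e v x - weighted e v y
                = (norm x powr e) *\<^sub>R (v x - v y) + (norm x powr e - norm y powr e) *\<^sub>R v y"
              by (simp add: weighted_def algebra_simps)
            also have "norm \<dots> \<le> norm x powr e * norm (v x - v y) + \<bar>norm x powr e - norm y powr e\<bar> * norm (v y)"
              by (rule norm_triangle_le) simp
            also have "\<dots> \<le> M * (2 * K * d powr h) + (L * (d powr h * (2 * R + 1))) * K"
            proof (intro add_mono mult_mono)
              show "norm x powr e \<le> M" using bound sx by (simp add: M_def)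
              have "\<bar>norm x powr e - norm y powr e\<bar> \<le> L * \<bar>norm x - norm y\<bar>" using lip sx sy by auto
              also have "\<dots> \<le> L * (d powr h * (2 * R + 1))"
                using L dd norm_triangle_ineq3[of x y] by (intro mult_left_mono) (auto simp: d_def)
              finally show "\<bar>norm x powr e - norm y powr e\<bar> \<le> L * (d powr h * (2 * R + 1))" .
            qed (use vh vb M L \<delta> K0 in \<open>auto simp: d_def\<close>)
            also have "\<dots> = 2 * (C * K) * d powr h - L * (2 * R + 1) * K * d powr h"
              by (simp add: C_def algebra_simps)
            also have "\<dots> \<le> 2 * (C * K) * d powr h" using L \<delta> K0 by simp
            finally show ?thesis .
          qed
        qed
        show "norm (weighted e v x - weighted e v y) \<le> 2 * (C * K) * norm (x - y) powr (- (real DIM(real ^ 'n) * s))"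
          using ineq by (simp add: d_def h_def)
      qed (use False C M K0 in auto)
    qed
  qed (use C M in simp)
qed

section \<open>Comparison with the norms of the scale\<close>

lemma mi_order_eq_0_iff: "mi_order \<alpha> = 0 \<longleftrightarrow> \<alpha> = (\<lambda>_. 0)"
  by (auto simp: mi_order_def)

lemma mi_deriv_zero: "mi_deriv (\<lambda>_. 0) v = v"
proof -
  have "(SOME l :: 'a list. \<forall>i. count_list l i = 0) = []"
  proof (rule some_equality)
    fix l :: "'a list" assume "\<forall>i. count_list l i = 0"
    then have "set l = {}" by (simp add: count_list_0_iff)
    then show "l = []" by simp
  qed simp
  then show ?thesis by (simp add: mi_deriv_def)
qed

lemma hoelder_order_eq_0:
  assumes "- 1 / real CARD('n::finite) < s" "s < 0"
  shows "hoelder_order CARD('n) s = 0"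
proof -
  have "real CARD('n) * s < 0" using assms by (simp add: mult_pos_neg)
  moreover have "- 1 < real CARD('n) * s" using assms by (simp add: field_simps)
  ultimately have "\<lfloor>real CARD('n) * s + 1\<rfloor> = 0" by linarith
  then show ?thesis by (simp add: hoelder_order_def)
qed

lemma X_enorm_negative:
  fixes v :: "real ^ 'n \<Rightarrow> 'b::real_normed_vector"
  assumes "- 1 / real CARD('n) < s" "s < 0"
  shows "X_enorm s UNIV v = (SUP x. ennreal (norm (v x))) +
    (SUP (x, y) \<in> {(x, y). x \<noteq> y}. ennreal (norm (v x - v y) / norm (x - y) powr (- (real CARD('n) * s))))"
proof -
  have k: "hoelder_order CARD('n) s = 0" by (rule hoelder_order_eq_0[OF assms])
  then have h: "hoelder_exp CARD('n) s = - (real CARD('n) * s)" by (simp add: hoelder_exp_def)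
  have sets: "{\<alpha> :: 'n multi_index. mi_order \<alpha> = 0} = {\<lambda>_. 0}" by (auto simp: mi_order_eq_0_iff)
  show ?thesis
    using assms unfolding X_enorm_def k h by (simp add: hoelder_enorm_def sets mi_deriv_zero)
qed

text \<open>
A nonempty open set is never negligible; this is how almost-everywhere information about continuous
functions becomes pointwise.
\<close>
lemma AE_lebesgue_imp_everywhere:
  fixes P :: "'a::euclidean_space \<Rightarrow> bool"
  assumes "AE x in lebesgue. P x" "open {x. \<not> P x}"
  shows "P x"
proof -
  have "{x. \<not> P x} \<in> sets lebesgue" using assms(2) by auto
  then have "{x. \<not> P x} \<in> null_sets lebesgue" using assms(1) by (auto simp: AE_iff_null_sets)
  then have "negligible {x. \<not> P x}" by (simp add: negligible_iff_null_sets)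
  then have "{x. \<not> P x} = {}" using assms(2) open_not_negligible by blast
  then show ?thesis by blast
qed

text \<open>
For a negative exponent the supremum contributes \<open>K\<close> and the Hoelder quotient \<open>2 * K\<close>.
\<close>
lemma X_enorm_le:
  fixes v :: "real ^ 'n \<Rightarrow> 'b::real_normed_vector"
  assumes v: "continuous_on UNIV v" and s: "- 1 / real CARD('n) < s" and le: "scale_le s v K"
  shows "X_enorm s UNIV v \<le> ennreal (3 * K)"
proof -
  have K0: "K \<ge> 0" using le by (rule scale_le_nonneg)
  have m: "(\<lambda>x. norm (v x)) \<in> borel_measurable borel"
    using v by (intro borel_measurable_continuous_onI continuous_intros)
  consider "s > 0" | "s = 0" | "s < 0" by linarith
  then show ?thesis
  proof cases
    case 1
    define I where "I = (\<integral>\<^sup>+x. ennreal (norm (v x) powr (1 / s)) \<partial>lborel)"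
    have I: "I \<le> ennreal (K powr (1 / s))" using scale_le_posD[OF le 1] by (simp add: I_def)
    have "enn2real I powr s \<le> (K powr (1 / s)) powr s"
      using I 1 by (intro powr_mono2 enn2real_leI) auto
    then have "enn2real I powr s \<le> 3 * K" using K0 1 by (simp add: powr_powr)
    moreover have "I \<noteq> \<infinity>" using I by (auto simp: top_unique)
    ultimately show ?thesis
      using 1 by (simp add: X_enorm_def Lp_enorm_def lebesgue_on_UNIV_eq nn_integral_completion ennreal_leI flip: I_def)
  next
    case 2
    have "esssup lebesgue (\<lambda>x. ennreal (norm (v x))) \<le> ennreal K"
    proof (rule esssup_I)
      show "(\<lambda>x. ennreal (norm (v x))) \<in> borel_measurable lebesgue"
        using m by (intro measurable_compose[OF _ measurable_ennreal] measurable_completion) auto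
      show "AE x in lebesgue. ennreal (norm (v x)) \<le> ennreal K"
        using scale_le_nonposD(1)[OF le] 2 by (auto intro: ennreal_leI)
    qed
    also have "\<dots> \<le> ennreal (3 * K)" using K0 by (intro ennreal_leI) auto
    finally show ?thesis using 2 by (simp add: X_enorm_def lebesgue_on_UNIV_eq)
  next
    case 3
    have "X_enorm s UNIV v \<le> ennreal K + ennreal (2 * K)"
      unfolding X_enorm_negative[OF s 3]
    proof (intro add_mono SUP_least)
      show "ennreal (norm (v x)) \<le> ennreal K" for x
        using scale_le_nonposD(1)[OF le] 3 by (auto intro: ennreal_leI)
      fix z assume z: "z \<in> {(x, y :: real ^ 'n). x \<noteq> y}"
      obtain x y where xy: "z = (x, y)" by fastforce
      with z have "norm (x - y) > 0" by auto
      then have "norm (v x - v y) / norm (x - y) powr (- (real CARD('n) * s)) \<le> 2 * K"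
        using scale_le_nonposD(2)[OF le, of x y] 3 by (simp add: field_simps)
      then show "(case z of (x, y) \<Rightarrow> ennreal (norm (v x - v y) / norm (x - y) powr (- (real CARD('n) * s)))) \<le> ennreal (2 * K)"
        by (simp add: xy ennreal_leI)
    qed
    also have "\<dots> = ennreal (3 * K)" using K0 by (subst ennreal_plus[symmetric]) auto
    finally show ?thesis .
  qed
qed

text \<open>
Finiteness has to be known beforehand, because \<open>X_norm\<close> sends an infinite norm to \<open>0\<close>.
\<close>
lemma scale_le_X_norm:
  fixes v :: "real ^ 'n \<Rightarrow> 'b::real_normed_vector"
  assumes v: "continuous_on UNIV v" and s: "- 1 / real CARD('n) < s" and fin: "X_enorm s UNIV v < \<infinity>"
  shows "scale_le s v (X_norm s UNIV v)"
proof -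
  define K where "K = X_norm s UNIV v"
  have K0: "K \<ge> 0" by (simp add: K_def X_norm_def)
  have K: "X_enorm s UNIV v = ennreal K" using fin by (simp add: K_def X_norm_def)
  consider "s > 0" | "s = 0" | "s < 0" by linarith
  then have "scale_le s v K"
  proof cases
    case 1
    define I where "I = (\<integral>\<^sup>+x. ennreal (norm (v x) powr (1 / s)) \<partial>lborel)"
    have E: "X_enorm s UNIV v = (if I = \<infinity> then \<infinity> else ennreal (enn2real I powr s))"
      using 1 by (simp add: X_enorm_def Lp_enorm_def lebesgue_on_UNIV_eq nn_integral_completion flip: I_def)
    then have I: "I \<noteq> \<infinity>" using fin by auto
    then have "K = enn2real I powr s" using E K K0 by simp
    then have "K powr (1 / s) = enn2real I" using 1 by (simp add: powr_powr)
    then show ?thesis using 1 K0 I by (intro scale_le_posI) (auto simp: less_top simp flip: I_def)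
  next
    case 2
    have "AE x in lebesgue. ennreal (norm (v x)) \<le> ennreal K"
      using esssup_AE[of "\<lambda>x. ennreal (norm (v x))" lebesgue] K 2
      by (simp add: X_enorm_def lebesgue_on_UNIV_eq)
    then have "AE x in lebesgue. norm (v x) \<le> K" using K0 by (simp add: ennreal_le_iff)
    moreover have "open {x. \<not> norm (v x) \<le> K}"
      unfolding not_le using v by (intro open_Collect_less continuous_intros)
    ultimately have "norm (v x) \<le> K" for x by (rule AE_lebesgue_imp_everywhere)
    then show ?thesis unfolding 2 by (rule scale_le_0I)
  next
    case 3
    let ?S = "SUP (x, y) \<in> {(x, y). x \<noteq> y}. ennreal (norm (v x - v y) / norm (x - y) powr (- (real CARD('n) * s)))"
    have sum: "(SUP x. ennreal (norm (v x))) + ?S = ennreal K"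
      using X_enorm_negative[OF s 3, of v] K by simp
    show ?thesis
    proof (rule scale_le_nonposI)
      show "norm (v x) \<le> K" for x
      proof -
        have "ennreal (norm (v x)) \<le> (SUP x. ennreal (norm (v x)))" by (intro SUP_upper) simp
        also have "\<dots> \<le> ennreal K" unfolding sum[symmetric] by (simp add: add_increasing2)
        finally show ?thesis using K0 by simp
      qed
      fix x y :: "real ^ 'n" assume xy: "x \<noteq> y"
      let ?d = "norm (x - y) powr (- (real CARD('n) * s))"
      have "ennreal (norm (v x - v y) / ?d) \<le> ?S" using xy by (intro SUP_upper2[of "(x, y)"]) auto
      also have "\<dots> \<le> ennreal K" unfolding sum[symmetric] by (simp add: add_increasing)
      finally have "norm (v x - v y) / ?d \<le> K" using K0 by simp
      then have "norm (v x - v y) \<le> K * ?d" using xy by (simp add: field_simps)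
      also have "\<dots> \<le> 2 * K * ?d" using K0 by (intro mult_right_mono) auto
      finally show "norm (v x - v y) \<le> 2 * K * norm (x - y) powr (- (real DIM(real ^ 'n) * s))" by simp
    qed (use 3 K0 in auto)
  qed
  then show ?thesis by (simp add: K_def)
qed

lemma scale_le_0_imp_zero:
  fixes v :: "'a::euclidean_space \<Rightarrow> 'b::real_normed_vector"
  assumes v: "continuous_on UNIV v" and le: "scale_le s v 0"
  shows "v x = 0"
proof (cases "s > 0")
  case True
  have [measurable]: "(\<lambda>x. norm (v x)) \<in> borel_measurable borel"
    using v by (intro borel_measurable_continuous_onI continuous_intros)
  have "(\<integral>\<^sup>+x. ennreal (norm (v x) powr (1 / s)) \<partial>lborel) = 0"
    using scale_le_posD[OF le True] by simp
  then have "AE x in lborel. ennreal (norm (v x) powr (1 / s)) = 0"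
    by (subst (asm) nn_integral_0_iff_AE) auto
  then have "AE x in lebesgue. v x = 0"
    by (intro AE_completion) (auto simp: ennreal_eq_0_iff)
  moreover have "open {x. v x \<noteq> 0}" using v by (intro open_Collect_neq continuous_intros)
  ultimately show ?thesis by (rule AE_lebesgue_imp_everywhere)
next
  case False
  then show ?thesis using scale_le_nonposD(1)[OF le, of x] by simp
qed

section \<open>Weighted functions and test functions\<close>

lemma continuous_on_weighted:
  fixes v :: "real ^ 'n \<Rightarrow> 'b::real_normed_vector"
  assumes v: "continuous_on UNIV v" and "\<delta> > 0" and supp: "\<And>x. v x \<noteq> 0 \<Longrightarrow> \<delta> \<le> norm x"
  shows "continuous_on UNIV (weighted e v)"
proof -
  have "continuous_on (- {0}) (weighted e v)"
    unfolding weighted_def by (intro continuous_intros continuous_on_subset[OF v]) auto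
  moreover have "continuous_on (ball 0 \<delta>) (weighted e v)"
  proof (rule continuous_on_eq[of _ "\<lambda>_. 0"])
    show "0 = weighted e v x" if "x \<in> ball 0 \<delta>" for x
      using supp[of x] that by (cases "v x = 0") (auto simp: weighted_def)
  qed auto
  ultimately have "continuous_on (- {0} \<union> ball 0 \<delta>) (weighted e v)"
    by (intro continuous_on_open_Un) auto
  moreover have "- {0} \<union> ball 0 \<delta> = (UNIV :: (real ^ 'n) set)" using \<open>\<delta> > 0\<close> by auto
  ultimately show ?thesis by simp
qed

lemma weighted_minus_cancel:
  assumes "v 0 = 0"
  shows "weighted e (weighted (- e) v) = v"
proof
  fix x
  show "weighted e (weighted (- e) v) x = v x"
    using assms by (cases "x = 0") (auto simp: weighted_def simp flip: powr_add)
qed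

lemma has_derivative_grad:
  fixes u :: "real ^ 'n \<Rightarrow> real"
  assumes "u differentiable (at x)"
  shows "(u has_derivative (\<lambda>h. grad u x \<bullet> h)) (at x)"
proof -
  let ?D = "frechet_derivative u (at x)"
  have D: "(u has_derivative ?D) (at x)" using assms by (simp add: frechet_derivative_works)
  then have lin: "linear ?D" by (rule has_derivative_linear)
  have "?D h = grad u x \<bullet> h" for h
  proof -
    have "?D h = ?D (\<Sum>i\<in>UNIV. h $ i *\<^sub>R axis i 1)"
      using basis_expansion[of h] by (simp add: scalar_mult_eq_scaleR)
    also have "\<dots> = (\<Sum>i\<in>UNIV. h $ i * ?D (axis i 1))"
      using lin by (simp add: linear_sum linear_cmul)
    also have "\<dots> = grad u x \<bullet> h"
      by (simp add: inner_vec_def grad_def partial_deriv_def mult.commute)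
    finally show ?thesis .
  qed
  then have "?D = (\<lambda>h. grad u x \<bullet> h)" by auto
  with D show ?thesis by simp
qed

lemma Cc_infty_facts:
  fixes u :: "real ^ 'n \<Rightarrow> real"
  assumes u: "u \<in> Cc_infty \<Omega>"
  shows "continuous_on UNIV u"
    and "(u has_derivative (\<lambda>h. grad u x \<bullet> h)) (at x)"
    and "continuous_on UNIV (grad u)"
    and "u x \<noteq> 0 \<Longrightarrow> x \<in> \<Omega>"
    and "grad u x \<noteq> 0 \<Longrightarrow> x \<in> \<Omega>"
proof -
  have Ck: "C_k_on k u UNIV" for k using u by (simp add: Cc_infty_def)
  have sub: "closure {x. u x \<noteq> 0} \<subseteq> \<Omega>" using u by (simp add: Cc_infty_def)
  show "continuous_on UNIV u" using Ck[of 0] by simp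
  have diff: "u differentiable (at x)" for x using Ck[of 1] by simp
  then show "(u has_derivative (\<lambda>h. grad u x \<bullet> h)) (at x)" by (rule has_derivative_grad)
  have "continuous_on UNIV (partial_deriv i u)" for i using Ck[of 1] by simp
  then show "continuous_on UNIV (grad u)" unfolding grad_def by (intro continuous_on_vec_lambda) auto
  show "x \<in> \<Omega>" if "u x \<noteq> 0" using that sub closure_subset[of "{x. u x \<noteq> 0}"] by auto
  show "x \<in> \<Omega>" if "grad u x \<noteq> 0"
  proof (rule ccontr)
    assume "x \<notin> \<Omega>"
    then have x: "x \<in> - closure {x. u x \<noteq> 0}" using sub by auto
    have "((\<lambda>_. 0) has_derivative (\<lambda>h. grad u x \<bullet> h)) (at x)"
    proof (rule has_derivative_transform_within_open[OF has_derivative_grad[OF diff] _ x])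
      show "u y = 0" if "y \<in> - closure {x. u x \<noteq> 0}" for y
        using that closure_subset[of "{x. u x \<noteq> 0}"] by auto
    qed auto
    then have "(\<lambda>h. grad u x \<bullet> h) = (\<lambda>h. 0)"
      by (rule has_derivative_unique) (rule has_derivative_const)
    then have "grad u x \<bullet> grad u x = 0" by metis
    with that show False by simp
  qed
qed

section \<open>The weighted interpolation inequality\<close>

text \<open>
Sobolev's or Morrey's inequality, according to the sign of \<open>s - 1 / n\<close>, followed by the nesting of the
scale, which gives up part of the gain \<open>1 / n\<close> in the reciprocal exponent.
\<close>
lemma gradient_embedding:
  fixes s t R :: real
  assumes n: "DIM('a::euclidean_space) \<ge> 2"
    and s: "0 < s" "s \<le> 1" "s \<noteq> 1 / real DIM('a)" and t: "s - 1 / real DIM('a) \<le> t" and R: "R \<ge> 0"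
  obtains C where "C > 0"
    "\<And>(u :: 'a \<Rightarrow> real) G A. (\<And>x. (u has_derivative (\<lambda>h. G x \<bullet> h)) (at x)) \<Longrightarrow> continuous_on UNIV G \<Longrightarrow>
       (\<And>x. u x \<noteq> 0 \<Longrightarrow> norm x \<le> R) \<Longrightarrow> scale_le s G A \<Longrightarrow> scale_le t u (C * A)"
proof -
  define n where "n = real DIM('a)"
  have n2: "n \<ge> 2" using n by (simp add: n_def)
  obtain C1 where C1: "C1 > 0"
    "\<And>(u :: 'a \<Rightarrow> real) G A. (\<And>x. (u has_derivative (\<lambda>h. G x \<bullet> h)) (at x)) \<Longrightarrow> continuous_on UNIV G \<Longrightarrow>
       (\<And>x. u x \<noteq> 0 \<Longrightarrow> norm x \<le> R) \<Longrightarrow> scale_le s G A \<Longrightarrow> scale_le (s - 1 / n) u (C1 * A)"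
  proof (cases "s > 1 / n")
    case True
    then have "n * s > 1" using n2 by (simp add: field_simps)
    then have "(n - 1) / (n * s - 1) > 0" using n2 by simp
    then show ?thesis
      using that[of "(n - 1) / (n * s - 1)"] sobolev_inequality[OF n, where R = R and s = s] True s(2)
      unfolding n_def by blast
  next
    case False
    then have "s < 1 / real DIM('a)" using s(3) by (simp add: n_def)
    from morrey_inequality[OF s(1) this R] show ?thesis using that unfolding n_def by blast
  qed
  obtain C2 where C2: "C2 > 0"
    "\<And>(v :: 'a \<Rightarrow> real) K. continuous_on UNIV v \<Longrightarrow>
       (\<And>x. v x \<noteq> 0 \<Longrightarrow> norm x \<le> R) \<Longrightarrow> scale_le (s - 1 / n) v K \<Longrightarrow> scale_le t v (C2 * K)"
    using scale_le_embedding[OF t R, where 'a = 'a and 'b = real] unfolding n_def by blast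
  show ?thesis
  proof (rule that[of "C2 * C1"])
    fix u :: "'a \<Rightarrow> real" and G A
    assume deriv: "\<And>x. (u has_derivative (\<lambda>h. G x \<bullet> h)) (at x)" and G: "continuous_on UNIV G"
      and supp: "\<And>x. u x \<noteq> 0 \<Longrightarrow> norm x \<le> R" and le: "scale_le s G A"
    have "continuous_on UNIV u"
      using has_derivative_continuous[OF deriv] by (simp add: continuous_on_eq_continuous_at)
    from C2(2)[OF this supp C1(2)[OF deriv G supp le]]
    show "scale_le t u (C2 * C1 * A)" by (simp add: mult.assoc)
  qed (use C1 C2 in simp)
qed

lemma convex_combination_greater:
  fixes m t r \<theta> :: real
  assumes "m < t" "m < r" "0 \<le> \<theta>" "\<theta> \<le> 1"
  shows "m < \<theta> * t + (1 - \<theta>) * r"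
proof (cases "\<theta> = 0")
  case False
  have "\<theta> * m < \<theta> * t" using False assms by (intro mult_strict_left_mono) auto
  moreover have "(1 - \<theta>) * m \<le> (1 - \<theta>) * r" using assms by (intro mult_left_mono) auto
  moreover have "\<theta> * m + (1 - \<theta>) * m = m" by (simp add: algebra_simps)
  ultimately show ?thesis by linarith
qed (use assms in simp)

text \<open>
The weight is stripped from \<open>grad u\<close> and from \<open>u\<close>, the unweighted inequalities are applied, and the
weight is put on the result; each constant is that of one of these steps.
\<close>
lemma weighted_interpolation_inequality:
  fixes \<Omega> :: "(real ^ 'n) set"
    and s r q a b c lam \<theta> \<delta> R :: real
  assumes n: "CARD('n) \<ge> 2"
    and \<delta>: "0 < \<delta>" "\<delta> \<le> R" and \<Omega>: "\<And>x. x \<in> \<Omega> \<Longrightarrow> \<delta> \<le> norm x \<and> norm x \<le> R"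
    and s: "0 < s" "s \<le> 1" "s \<noteq> 1 / real CARD('n)" and r: "- 1 / real CARD('n) < r"
    and lam: "lam \<le> 1" and \<theta>: "0 \<le> \<theta>" "\<theta> \<le> 1"
    and q: "q = \<theta> * (s - lam / real CARD('n)) + (1 - \<theta>) * r"
  obtains C where "C > 0"
    "\<And>u. u \<in> Cc_infty \<Omega> \<Longrightarrow> X_enorm r UNIV (weighted (- c) u) < \<infinity> \<Longrightarrow>
       X_enorm q UNIV (weighted (- b) u)
         \<le> ennreal (C * X_norm s UNIV (weighted (- a) (grad u)) powr \<theta>
                      * X_norm r UNIV (weighted (- c) u) powr (1 - \<theta>))"
proof -
  let ?n = "real CARD('n)"
  have R: "R \<ge> 0" using \<delta> by simp
  have n1: "?n > 0" by simp
  define t where "t = s - lam / ?n"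
  have "lam / ?n \<le> 1 / ?n" using lam by (intro divide_right_mono) auto
  then have t: "s - 1 / ?n \<le> t" by (simp add: t_def)
  have t': "- 1 / ?n < t" using t s by simp
  have q': "- 1 / ?n < q"
    unfolding q t_def[symmetric] by (rule convex_combination_greater[OF t' r \<theta>])
  have s': "- 1 / ?n < s" using s n1 by (smt (verit) divide_nonpos_pos)
  obtain C1 where C1: "C1 > 0"
    "\<And>(v :: real ^ 'n \<Rightarrow> real ^ 'n) K. continuous_on UNIV v \<Longrightarrow>
       (\<And>x. v x \<noteq> 0 \<Longrightarrow> \<delta> \<le> norm x \<and> norm x \<le> R) \<Longrightarrow> scale_le s v K \<Longrightarrow> scale_le s (weighted a v) (C1 * K)"
    using scale_le_weighted[OF s' \<delta>, where 'b = "real ^ 'n" and e = a] by metis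
  obtain C2 where C2: "C2 > 0"
    "\<And>(u :: real ^ 'n \<Rightarrow> real) G A. (\<And>x. (u has_derivative (\<lambda>h. G x \<bullet> h)) (at x)) \<Longrightarrow> continuous_on UNIV G \<Longrightarrow>
       (\<And>x. u x \<noteq> 0 \<Longrightarrow> norm x \<le> R) \<Longrightarrow> scale_le s G A \<Longrightarrow> scale_le t u (C2 * A)"
    using gradient_embedding[where 'a = "real ^ 'n", of s t R] n s t R by auto
  obtain C3 where C3: "C3 > 0"
    "\<And>(v :: real ^ 'n \<Rightarrow> real) K. continuous_on UNIV v \<Longrightarrow>
       (\<And>x. v x \<noteq> 0 \<Longrightarrow> \<delta> \<le> norm x \<and> norm x \<le> R) \<Longrightarrow> scale_le r v K \<Longrightarrow> scale_le r (weighted c v) (C3 * K)"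
    using scale_le_weighted[OF r \<delta>, where 'b = real and e = c] by metis
  obtain C4 where C4: "C4 > 0"
    "\<And>(v :: real ^ 'n \<Rightarrow> real) A B. continuous_on UNIV v \<Longrightarrow> scale_le t v A \<Longrightarrow> scale_le r v B \<Longrightarrow>
       A > 0 \<Longrightarrow> B > 0 \<Longrightarrow> scale_le (\<theta> * t + (1 - \<theta>) * r) v (C4 * (A powr \<theta> * B powr (1 - \<theta>)))"
    using scale_le_interpolate[OF \<theta>, where 'a = "real ^ 'n" and 'b = real] by metis
  obtain C5 where C5: "C5 > 0"
    "\<And>(v :: real ^ 'n \<Rightarrow> real) K. continuous_on UNIV v \<Longrightarrow>
       (\<And>x. v x \<noteq> 0 \<Longrightarrow> \<delta> \<le> norm x \<and> norm x \<le> R) \<Longrightarrow> scale_le q v K \<Longrightarrow> scale_le q (weighted (- b) v) (C5 * K)"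
    using scale_le_weighted[OF q' \<delta>, where 'b = real and e = "- b"] by metis
  obtain C6 where C6: "C6 > 0"
    "\<And>(v :: real ^ 'n \<Rightarrow> real ^ 'n) K. continuous_on UNIV v \<Longrightarrow>
       (\<And>x. v x \<noteq> 0 \<Longrightarrow> norm x \<le> R) \<Longrightarrow> scale_le 0 v K \<Longrightarrow> scale_le s v (C6 * K)"
    using scale_le_embedding[OF less_imp_le[OF s(1)] R, where 'a = "real ^ 'n" and 'b = "real ^ 'n"] by metis
  define C where "C = 3 * C5 * C4 * (C2 * C1) powr \<theta> * C3 powr (1 - \<theta>)"
  show ?thesis
  proof (rule that[of C])
    show "C > 0" using C1 C2 C3 C4 C5 by (simp add: C_def)
    fix u assume u: "u \<in> Cc_infty \<Omega>" and fin: "X_enorm r UNIV (weighted (- c) u) < \<infinity>"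
    note uc = Cc_infty_facts(1)[OF u] and ud = Cc_infty_facts(2)[OF u] and gc = Cc_infty_facts(3)[OF u]
    have us: "\<delta> \<le> norm x \<and> norm x \<le> R" if "u x \<noteq> 0" for x using Cc_infty_facts(4)[OF u that] \<Omega> by blast
    have gs: "\<delta> \<le> norm x \<and> norm x \<le> R" if "grad u x \<noteq> 0" for x using Cc_infty_facts(5)[OF u that] \<Omega> by blast
    have us': "\<And>x. u x \<noteq> 0 \<Longrightarrow> \<delta> \<le> norm x" and gs': "\<And>x. grad u x \<noteq> 0 \<Longrightarrow> \<delta> \<le> norm x" using us gs by auto
    have z: "u 0 = 0" "grad u 0 = 0" using us'[of 0] gs'[of 0] \<delta> by auto
    let ?U = "weighted (- c) u" and ?G = "weighted (- a) (grad u)"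
    have Uc: "continuous_on UNIV ?U" by (rule continuous_on_weighted[OF uc \<delta>(1) us'])
    have Gc: "continuous_on UNIV ?G" by (rule continuous_on_weighted[OF gc \<delta>(1) gs'])
    have Us: "\<delta> \<le> norm x \<and> norm x \<le> R" if "?U x \<noteq> 0" for x using that us[of x] by (auto simp: weighted_def)
    have Gs: "\<delta> \<le> norm x \<and> norm x \<le> R" if "?G x \<noteq> 0" for x using that gs[of x] by (auto simp: weighted_def)
    have Gs': "norm x \<le> R" if "?G x \<noteq> 0" for x using Gs[OF that] by simp
    obtain M where "M > 0" "\<And>x. norm (?G x) \<le> M"
      using bounded_support_continuous_bounded[OF Gc Gs'] by blast
    then have "scale_le s ?G (C6 * M)" by (intro C6(2) Gc Gs' scale_le_0I)
    from X_enorm_le[OF Gc s' this] have "X_enorm s UNIV ?G < \<infinity>"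
      by (rule order_le_less_trans) simp
    define A where "A = X_norm s UNIV ?G"
    define B where "B = X_norm r UNIV ?U"
    have A: "scale_le s ?G A" unfolding A_def by (rule scale_le_X_norm[OF Gc s']) fact
    have B: "scale_le r ?U B" unfolding B_def by (rule scale_le_X_norm[OF Uc r fin])
    have A0: "A \<ge> 0" and B0: "B \<ge> 0" using A B by (auto dest: scale_le_nonneg)
    have "scale_le s (grad u) (C1 * A)"
      using C1(2)[OF Gc Gs A] by (simp add: weighted_minus_cancel z)
    then have ut: "scale_le t u (C2 * (C1 * A))"
      using us by (intro C2(2)[OF ud gc]) auto
    have ur: "scale_le r u (C3 * B)"
      using C3(2)[OF Uc Us B] by (simp add: weighted_minus_cancel z)
    have Wc: "continuous_on UNIV (weighted (- b) u)" by (rule continuous_on_weighted[OF uc \<delta>(1) us'])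
    have "scale_le q (weighted (- b) u) (C / 3 * A powr \<theta> * B powr (1 - \<theta>))"
    \<comment> \<open>If one of the norms vanishes then so does \<open>u\<close>; this settles the cases with \<open>0 powr 0\<close>.\<close>
    proof (cases "A = 0 \<or> B = 0")
      case True
      then have "u = (\<lambda>_. 0)"
        using scale_le_0_imp_zero[OF uc, of t] scale_le_0_imp_zero[OF uc, of r] ut ur by auto
      then have "scale_le q (weighted (- b) u) 0" by (simp add: scale_le_def weighted_def)
      then show ?thesis using \<open>C > 0\<close> by (auto elim!: scale_le_mono)
    next
      case False
      then have "scale_le q u (C4 * ((C2 * (C1 * A)) powr \<theta> * (C3 * B) powr (1 - \<theta>)))"
        using C4(2)[OF uc ut ur] A0 B0 C1(1) C2(1) C3(1) by (simp add: q t_def)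
      from C5(2)[OF uc us this]
      show ?thesis
        using A0 B0 C1(1) C2(1) C3(1) by (simp add: C_def powr_mult mult_ac)
    qed
    from X_enorm_le[OF Wc q' this]
    show "X_enorm q UNIV (weighted (- b) u) \<le> ennreal (C * X_norm s UNIV ?G powr \<theta> * X_norm r UNIV ?U powr (1 - \<theta>))"
      by (simp add: A_def B_def)
  qed
qed

text \<open>
For \<open>r \<ge> 0\<close> boundedness and bounded support suffice. For \<open>r < 0\<close> the membership hypothesis provides
a representative with finite norm, and two continuous functions that agree almost everywhere are equal.
\<close>
lemma X_enorm_weighted_finite:
  fixes \<Omega> :: "(real ^ 'n) set"
  assumes \<delta>: "0 < \<delta>" "\<delta> \<le> R" and \<Omega>: "\<And>x. x \<in> \<Omega> \<Longrightarrow> \<delta> \<le> norm x \<and> norm x \<le> R"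
    and r: "- 1 / real CARD('n) < r" and u: "u \<in> Cc_infty \<Omega>" and uX: "u \<in> X_weighted 0 r c UNIV"
  shows "X_enorm r UNIV (weighted (- c) u) < \<infinity>"
proof -
  let ?U = "weighted (- c) u"
  have us: "\<delta> \<le> norm x \<and> norm x \<le> R" if "u x \<noteq> 0" for x using Cc_infty_facts(4)[OF u that] \<Omega> by blast
  have Uc: "continuous_on UNIV ?U"
    using us by (intro continuous_on_weighted[OF Cc_infty_facts(1)[OF u] \<delta>(1)]) auto
  have Us: "norm x \<le> R" if "?U x \<noteq> 0" for x using that us[of x] by (auto simp: weighted_def)
  show ?thesis
  proof (cases "r \<ge> 0")
    case True
    have R0: "0 \<le> R" using \<delta> by simp
    obtain M where M: "M > 0" "\<And>x. norm (?U x) \<le> M"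
      using bounded_support_continuous_bounded[OF Uc Us] by blast
    obtain C where C: "C > 0"
      "\<And>(v :: real ^ 'n \<Rightarrow> real) K. continuous_on UNIV v \<Longrightarrow>
         (\<And>x. v x \<noteq> 0 \<Longrightarrow> norm x \<le> R) \<Longrightarrow> scale_le 0 v K \<Longrightarrow> scale_le r v (C * K)"
      using scale_le_embedding[OF True R0, where 'a = "real ^ 'n" and 'b = real] by metis
    have "scale_le r ?U (C * M)" by (intro C(2) Uc Us scale_le_0I M)
    from X_enorm_le[OF Uc r this] show ?thesis by (rule order_le_less_trans) simp
  next
    case False
    have "mi_order (\<lambda>_. 0 :: nat) = 0" by (simp add: mi_order_eq_0_iff)
    with uX obtain w where w: "w \<in> X_space r UNIV" "AE x in lebesgue. w x = ?U x"
      unfolding X_weighted_def lebesgue_on_UNIV_eq by auto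
    have "C_k_on (hoelder_order CARD('n) r) w UNIV" using w(1) False by (auto simp: X_space_def)
    then have wc: "continuous_on UNIV w"
      by (cases "hoelder_order CARD('n) r")
         (auto intro!: continuous_at_imp_continuous_on differentiable_imp_continuous_within)
    have "open {x. w x \<noteq> ?U x}" using wc Uc by (intro open_Collect_neq)
    with w(2) have "w x = ?U x" for x by (rule AE_lebesgue_imp_everywhere)
    then have "w = ?U" by auto
    with w(1) show ?thesis by (simp add: X_space_def)
  qed
qed

lemma X_weighted_0I:
  fixes u :: "real ^ 'n \<Rightarrow> real"
  assumes s: "- 1 / real CARD('n) < s"
    and c: "continuous_on UNIV (weighted (- b) u)" and fin: "X_enorm s UNIV (weighted (- b) u) < \<infinity>"
  shows "u \<in> X_weighted 0 s b UNIV"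
proof -
  have "weighted (- b) u \<in> X_space s UNIV"
  proof (cases "s \<ge> 0")
    case True
    have "weighted (- b) u \<in> borel_measurable lebesgue"
      using borel_measurable_continuous_onI[OF c] by (intro measurable_completion) auto
    then show ?thesis using True fin by (simp add: X_space_def lebesgue_on_UNIV_eq)
  next
    case False
    then have "hoelder_order CARD('n) s = 0" using s by (intro hoelder_order_eq_0) auto
    then show ?thesis using False fin c by (simp add: X_space_def)
  qed
  then show ?thesis unfolding X_weighted_def by auto
qed

lemma annulus_bounds:
  fixes \<Omega> :: "'a::euclidean_space set"
  assumes "bounded \<Omega>" "\<Omega> = {} \<or> setdist \<Omega> {0} > 0"
  obtains \<delta> R where "0 < \<delta>" "\<delta> \<le> R" "\<And>x. x \<in> \<Omega> \<Longrightarrow> \<delta> \<le> norm x \<and> norm x \<le> R"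
proof (cases "\<Omega> = {}")
  case True
  then show ?thesis using that[of 1 1] by auto
next
  case False
  obtain R where R: "\<And>x. x \<in> \<Omega> \<Longrightarrow> norm x \<le> R" using assms(1) by (auto simp: bounded_iff)
  have "setdist \<Omega> {0} \<le> norm x" if "x \<in> \<Omega>" for x
    using setdist_le_dist[OF that, of 0 "{0}"] by simp
  then show ?thesis
    using False assms(2) R by (intro that[of "setdist \<Omega> {0}" "max R (setdist \<Omega> {0})"]) (auto simp: le_max_iff_disj)
qed

theorem theorem1p4:
  fixes \<Omega> :: "(real ^ 'n) set"
    and p_inv r_inv q_inv a b c lam \<theta> :: real
  assumes "CARD('n) \<ge> 2"
    and "open \<Omega>" and "bounded \<Omega>" and "\<Omega> \<subseteq> UNIV - {0}"
    and "\<Omega> = {} \<or> setdist \<Omega> {0} > 0"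
    and "p_inv \<in> {0<..<1 / real CARD('n)} \<union> {1 / real CARD('n)<..1}"
    and "r_inv \<in> {- 1 / real CARD('n)<..1}"
    and "lam \<in> {0..1}" and "\<theta> \<in> {0..1}"
    and "q_inv = \<theta> * (p_inv - lam / real CARD('n)) + (1 - \<theta>) * r_inv"
    and "b = \<theta> * (1 + a - lam) + (1 - \<theta>) * c"
  shows "(\<exists>C>0. \<forall>u \<in> Cc_infty \<Omega>.
            u \<in> X_weighted 1 p_inv a UNIV \<inter> X_weighted 0 r_inv c UNIV \<longrightarrow>
            u \<in> X_weighted 0 q_inv b UNIV \<and>
            X_norm q_inv UNIV (weighted (- b) u)
              \<le> C * X_norm p_inv UNIV (weighted (- a) (grad u)) powr \<theta>
                  * X_norm r_inv UNIV (weighted (- c) u) powr (1 - \<theta>)) \<and>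
         q_inv - b / real CARD('n)
           = \<theta> * (p_inv - (1 + a) / real CARD('n)) + (1 - \<theta>) * (r_inv - c / real CARD('n))"
proof
  let ?n = "real CARD('n)"
  obtain \<delta> R where \<delta>: "0 < \<delta>" "\<delta> \<le> R" and \<Omega>: "\<And>x. x \<in> \<Omega> \<Longrightarrow> \<delta> \<le> norm x \<and> norm x \<le> R"
    using annulus_bounds[OF assms(3,5)] by blast
  have n1: "1 / ?n > 0" "1 / ?n \<le> 1" by auto
  consider "0 < p_inv" "p_inv < 1 / ?n" | "1 / ?n < p_inv" "p_inv \<le> 1" using assms(6) by auto
  then have s: "0 < p_inv" "p_inv \<le> 1" "p_inv \<noteq> 1 / ?n" using n1 by (cases; linarith)+
  have r: "- 1 / ?n < r_inv" and lam: "lam \<le> 1" and \<theta>: "0 \<le> \<theta>" "\<theta> \<le> 1" using assms by auto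
  obtain C where C: "C > 0" and ineq:
    "\<And>u. u \<in> Cc_infty \<Omega> \<Longrightarrow> X_enorm r_inv UNIV (weighted (- c) u) < \<infinity> \<Longrightarrow>
       X_enorm q_inv UNIV (weighted (- b) u)
         \<le> ennreal (C * X_norm p_inv UNIV (weighted (- a) (grad u)) powr \<theta>
                      * X_norm r_inv UNIV (weighted (- c) u) powr (1 - \<theta>))"
    using weighted_interpolation_inequality[OF assms(1) \<delta> \<Omega> s r lam \<theta> assms(10), where a = a and b = b and c = c]
    by blast
  show "\<exists>C>0. \<forall>u \<in> Cc_infty \<Omega>.
            u \<in> X_weighted 1 p_inv a UNIV \<inter> X_weighted 0 r_inv c UNIV \<longrightarrow>
            u \<in> X_weighted 0 q_inv b UNIV \<and>
            X_norm q_inv UNIV (weighted (- b) u)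
              \<le> C * X_norm p_inv UNIV (weighted (- a) (grad u)) powr \<theta>
                  * X_norm r_inv UNIV (weighted (- c) u) powr (1 - \<theta>)"
  proof (intro exI[of _ C] conjI ballI impI C)
    fix u assume u: "u \<in> Cc_infty \<Omega>" and uX: "u \<in> X_weighted 1 p_inv a UNIV \<inter> X_weighted 0 r_inv c UNIV"
    have fin: "X_enorm r_inv UNIV (weighted (- c) u) < \<infinity>"
      using uX by (intro X_enorm_weighted_finite[OF \<delta> \<Omega> r u]) auto
    note le = ineq[OF u fin]
    show "X_norm q_inv UNIV (weighted (- b) u)
              \<le> C * X_norm p_inv UNIV (weighted (- a) (grad u)) powr \<theta>
                  * X_norm r_inv UNIV (weighted (- c) u) powr (1 - \<theta>)"
      unfolding X_norm_def[of q_inv] using C by (intro enn2real_leI le) auto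
    show "u \<in> X_weighted 0 q_inv b UNIV"
    proof (rule X_weighted_0I)
      show "- 1 / ?n < q_inv"
      proof -
        have "lam / ?n \<le> 1 / ?n" using lam by (intro divide_right_mono) auto
        then have "- 1 / ?n < p_inv - lam / ?n" using s(1) by simp
        then show ?thesis unfolding assms(10) by (rule convex_combination_greater[OF _ r \<theta>])
      qed
      show "X_enorm q_inv UNIV (weighted (- b) u) < \<infinity>"
        using le by (rule order_le_less_trans) simp
      show "continuous_on UNIV (weighted (- b) u)"
        using Cc_infty_facts(4)[OF u] \<Omega> by (intro continuous_on_weighted[OF Cc_infty_facts(1)[OF u] \<delta>(1)]) auto
    qed
  qed
  show "q_inv - b / ?n = \<theta> * (p_inv - (1 + a) / ?n) + (1 - \<theta>) * (r_inv - c / ?n)"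
    unfolding assms(10,11) by (simp add: field_simps)
qed

end
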